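(* Let $p\ge 5$ be an odd prime and set $\mathcal{O}=\mathbb{Z}[\zeta_p,i]=\mathbb{Z}[\zeta_{4p}]$ if $p\equiv 3 \pmod 4$ and $\mathcal{O}=\mathbb{Z}[\zeta_p]$ if $p\equiv 1\pmod 4$. Then the genus one mapping class group representation $\rho_1$ of $\mathrm{SL}(2,\mathbb{Z})$ given by the $\mathrm{SO}(p)_2$-TQFT can be defined over $\mathcal{O}$. That is, there exists $W\in \mathrm{GL}(H)$ (a change of basis of $H$) such that for every $M$ in the subgroup of $\mathrm{GL}(H)$ generated by the explicit matrices $\rho_1(\sigma)$ and $\rho_1(\tau)$, the matrix $W^{-1}MW$ has all its entries in $\mathcal{O}$; in particular $W^{-1}\rho_1(\sigma)W$ and $W^{-1}\rho_1(\tau)W$ have entries in $\mathcal{O}$.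
   Context: Let $r=\frac{p-1}{2}$, $\zeta_n=e^{2\pi i/n}$, $\zeta=\zeta_p$, $\psi=e^{2\pi i r/8}$, and $\theta_j=\zeta^{rj^2}$ for $j\in\mathbb{Z}$. Let $H$ be the complex vector space of dimension $r+4$ with fixed basis $\mathbf{1},\mathbf{Z},\mathbf{Y}_1,\dots,\mathbf{Y}_r,\mathbf{X},\mathbf{X}'$ (the simple objects of the modular category $\mathrm{SO}(p)_2$). Let $\sigma=\begin{bmatrix}0&-1\\1&0\end{bmatrix}$ and $\tau=\begin{bmatrix}1&1\\0&1\end{bmatrix}$ be generators of $\mathrm{SL}(2,\mathbb{Z})$. The genus one representation of the $\mathrm{SO}(p)_2$-TQFT is the projective representation $\rho_1:\mathrm{SL}(2,\mathbb{Z})\to\mathrm{PGL}(H)$ given on generators by the classes of the following explicit linear maps, also denoted $\rho_1(\sigma),\rho_1(\tau)$ and identified with their matrices in the fixed basis: $\rho_1(\sigma)\mathbf{1}=\frac{1}{2\sqrt p}(\mathbf{1}+\mathbf{Z})+\frac{1}{\sqrt p}\sum_{k=1}^r\mathbf{Y}_k+\frac12(\mathbf{X}+\mathbf{X}')$, $\rho_1(\sigma)\mathbf{Z}=\frac{1}{2\sqrt p}(\mathbf{1}+\mathbf{Z})+\frac{1}{\sqrt p}\sum_{k=1}^r\mathbf{Y}_k-\frac12(\mathbf{X}+\mathbf{X}')$, $\rho_1(\sigma)\mathbf{Y}_j=\frac{1}{\sqrt p}(\mathbf{1}+\mathbf{Z})+\sum_{k=1}^r A_{kj}\mathbf{Y}_k$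 for $1\le j\le r$, where $A_{jk}=\frac{2}{\sqrt p}\cos\frac{2\pi jk}{p}=\frac{1}{\sqrt p}(\zeta^{jk}+\zeta^{-jk})$, $\rho_1(\sigma)\mathbf{X}=\frac12(\mathbf{1}-\mathbf{Z})+\frac12(\mathbf{X}-\mathbf{X}')$, $\rho_1(\sigma)\mathbf{X}'=\frac12(\mathbf{1}-\mathbf{Z})-\frac12(\mathbf{X}-\mathbf{X}')$; and $\rho_1(\tau)$ is diagonal with $\mathbf{1}\mapsto\mathbf{1}$, $\mathbf{Z}\mapsto\mathbf{Z}$, $\mathbf{Y}_j\mapsto\theta_j\mathbf{Y}_j$, $\mathbf{X}\mapsto\psi\mathbf{X}$, $\mathbf{X}'\mapsto-\psi\mathbf{X}'$. *)

theory Defs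
  imports
    "HOL-Analysis.Analysis"
    "HOL-Computational_Algebra.Primes"
    "HOL-Algebra.Generated_Groups"
    "HOL-Algebra.Generated_Rings"
    "HOL-Algebra.Algebraic_Closure_Type"
    "Jordan_Normal_Form.Matrix"
begin

definition zeta :: "nat \<Rightarrow> complex" where
  "zeta n = exp (2 * complex_of_real pi * \<i> / of_nat n)"

definition half :: "nat \<Rightarrow> nat" where
  "half p = (p - 1) div 2"

definition psi :: "nat \<Rightarrow> complex" where
  "psi p = exp (2 * complex_of_real pi * \<i> * of_nat (half p) / 8)"

definition theta :: "nat \<Rightarrow> nat \<Rightarrow> complex" where
  "theta p j = zeta p ^ (half p * j\<^sup>2)"

text \<open>The simple objects; only \<open>Obj_Y 1, \<dots>, Obj_Y r\<close> with \<open>r = half p\<close> occur in the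
  basis of \<open>H\<close>, which is ordered as \<open>1, Z, Y\<^sub>1, \<dots>, Y\<^sub>r, X, X'\<close>.\<close>

datatype simple_obj = Obj_1 | Obj_Z | Obj_Y nat | Obj_X | Obj_X'

definition dim_H :: "nat \<Rightarrow> nat" where
  "dim_H p = half p + 4"

definition basis_H :: "nat \<Rightarrow> simple_obj list" where
  "basis_H p = [Obj_1, Obj_Z] @ map Obj_Y [1..<half p + 1] @ [Obj_X, Obj_X']"

text \<open>\<open>sigma_coeff p a b\<close> is the coefficient of \<open>b\<close> in the image of the basis vector \<open>a\<close>.\<close>

fun sigma_coeff :: "nat \<Rightarrow> simple_obj \<Rightarrow> simple_obj \<Rightarrow> complex" where
  "sigma_coeff p Obj_1 b = (case b of
       Obj_1 \<Rightarrow> 1 / (2 * complex_of_real (sqrt p))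
     | Obj_Z \<Rightarrow> 1 / (2 * complex_of_real (sqrt p))
     | Obj_Y k \<Rightarrow> 1 / complex_of_real (sqrt p)
     | Obj_X \<Rightarrow> 1 / 2
     | Obj_X' \<Rightarrow> 1 / 2)"
| "sigma_coeff p Obj_Z b = (case b of
       Obj_1 \<Rightarrow> 1 / (2 * complex_of_real (sqrt p))
     | Obj_Z \<Rightarrow> 1 / (2 * complex_of_real (sqrt p))
     | Obj_Y k \<Rightarrow> 1 / complex_of_real (sqrt p)
     | Obj_X \<Rightarrow> - 1 / 2
     | Obj_X' \<Rightarrow> - 1 / 2)"
| "sigma_coeff p (Obj_Y j) b = (case b of
       Obj_1 \<Rightarrow> 1 / complex_of_real (sqrt p)
     | Obj_Z \<Rightarrow> 1 / complex_of_real (sqrt p)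
     | Obj_Y k \<Rightarrow> complex_of_real (2 / sqrt p * cos (2 * pi * real k * real j / real p))
     | Obj_X \<Rightarrow> 0
     | Obj_X' \<Rightarrow> 0)"
| "sigma_coeff p Obj_X b = (case b of
       Obj_1 \<Rightarrow> 1 / 2
     | Obj_Z \<Rightarrow> - 1 / 2
     | Obj_Y k \<Rightarrow> 0
     | Obj_X \<Rightarrow> 1 / 2
     | Obj_X' \<Rightarrow> - 1 / 2)"
| "sigma_coeff p Obj_X' b = (case b of
       Obj_1 \<Rightarrow> 1 / 2
     | Obj_Z \<Rightarrow> - 1 / 2
     | Obj_Y k \<Rightarrow> 0
     | Obj_X \<Rightarrow> - 1 / 2
     | Obj_X' \<Rightarrow> 1 / 2)"

fun tau_eigenvalue :: "nat \<Rightarrow> simple_obj \<Rightarrow> complex" where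
  "tau_eigenvalue p Obj_1 = 1"
| "tau_eigenvalue p Obj_Z = 1"
| "tau_eigenvalue p (Obj_Y j) = theta p j"
| "tau_eigenvalue p Obj_X = psi p"
| "tau_eigenvalue p Obj_X' = - psi p"

text \<open>Matrices of linear maps act on column vectors, so the image of the \<open>j\<close>-th basis vector is
  the \<open>j\<close>-th column.\<close>

definition rho_sigma :: "nat \<Rightarrow> complex mat" where
  "rho_sigma p = mat (dim_H p) (dim_H p)
     (\<lambda>(i, j). sigma_coeff p (basis_H p ! j) (basis_H p ! i))"

definition rho_tau :: "nat \<Rightarrow> complex mat" where
  "rho_tau p = mat (dim_H p) (dim_H p)
     (\<lambda>(i, j). if i = j then tau_eigenvalue p (basis_H p ! j) else 0)"

definition GL :: "nat \<Rightarrow> complex mat monoid" where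
  "GL n = units_of (ring_mat TYPE(complex) n ())"

definition rho_image :: "nat \<Rightarrow> complex mat set" where
  "rho_image p = generate (GL (dim_H p)) {rho_sigma p, rho_tau p}"

definition int_adjoin :: "complex set \<Rightarrow> complex set" where
  "int_adjoin S = generate_ring ring_of_type_algebra S"

definition coeff_ring :: "nat \<Rightarrow> complex set" where
  "coeff_ring p = (if p mod 4 = 3 then int_adjoin {zeta p, \<i>} else int_adjoin {zeta p})"

lemma length_basis_H: "length (basis_H p) = dim_H p"
  by (simp add: basis_H_def dim_H_def)

lemma int_adjoin_incl: "x \<in> S \<Longrightarrow> x \<in> int_adjoin S"
  by (simp add: int_adjoin_def generate_ring.incl)

lemma int_adjoin_one: "1 \<in> int_adjoin S"
  using generate_ring.one[of "ring_of_type_algebra :: complex ring" S]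
  by (simp add: int_adjoin_def ring_of_type_algebra_def)

lemma int_adjoin_add: "x \<in> int_adjoin S \<Longrightarrow> y \<in> int_adjoin S \<Longrightarrow> x + y \<in> int_adjoin S"
  using generate_ring.eng_add[of x "ring_of_type_algebra :: complex ring" S y]
  by (simp add: int_adjoin_def ring_of_type_algebra_def)

lemma int_adjoin_mult: "x \<in> int_adjoin S \<Longrightarrow> y \<in> int_adjoin S \<Longrightarrow> x * y \<in> int_adjoin S"
  using generate_ring.eng_mult[of x "ring_of_type_algebra :: complex ring" S y]
  by (simp add: int_adjoin_def ring_of_type_algebra_def)

lemma int_adjoin_uminus:
  assumes "x \<in> int_adjoin S"
  shows "- x \<in> int_adjoin S"
proof -
  interpret R: ring "ring_of_type_algebra :: complex ring"
    by (rule ring_from_type_algebra)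
  have "\<ominus>\<^bsub>(ring_of_type_algebra :: complex ring)\<^esub> x = - x"
    by (rule R.minus_equality) (auto simp: ring_of_type_algebra_def)
  then show ?thesis
    using generate_ring.a_inv[of x "ring_of_type_algebra :: complex ring" S] assms
    by (simp add: int_adjoin_def)
qed

lemma int_adjoin_power: "x \<in> int_adjoin S \<Longrightarrow> x ^ n \<in> int_adjoin S"
  by (induction n) (auto intro: int_adjoin_one int_adjoin_mult)

lemma int_adjoin_least:
  assumes "S \<subseteq> int_adjoin T"
  shows "int_adjoin S \<subseteq> int_adjoin T"
proof
  fix x assume "x \<in> int_adjoin S"
  then have "x \<in> generate_ring ring_of_type_algebra S"
    by (simp add: int_adjoin_def)
  then show "x \<in> int_adjoin T"
  proof (induction rule: generate_ring.induct)
    case (incl h)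
    then show ?case using assms by blast
  qed (auto simp: int_adjoin_def intro: generate_ring.intros)
qed

lemma zeta_power: "zeta n ^ k = exp (2 * complex_of_real pi * \<i> * of_nat k / of_nat n)"
  by (simp add: zeta_def exp_of_nat_mult[symmetric] mult_ac)

lemma coeff_ring_3_mod_4:
  assumes "p mod 4 = 3"
  shows "coeff_ring p = int_adjoin {zeta (4 * p)}"
proof -
  have p0: "p \<noteq> 0" using assms by auto
  have z4: "zeta (4 * p) ^ 4 = zeta p"
    unfolding zeta_power by (simp add: zeta_def mult_ac)
  have zp: "zeta (4 * p) ^ p = \<i>"
  proof -
    have "2 * complex_of_real pi * \<i> * of_nat p / of_nat (4 * p) = \<i> * complex_of_real (pi / 2)"
      using p0 by simp
    then show ?thesis
      unfolding zeta_power by (metis cis_conv_exp cis_pi_half)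
  qed
  have "4 dvd p + 1" using assms by presburger
  then obtain m where m: "p + 1 = 4 * m" by (rule dvdE)
  have "zeta p ^ m = (zeta (4 * p) ^ 4) ^ m"
    by (simp only: z4)
  also have "\<dots> = zeta (4 * p) ^ (p + 1)"
    by (simp only: power_mult[symmetric] m)
  also have "\<dots> = \<i> * zeta (4 * p)"
    by (simp only: power_add zp power_one_right)
  finally have "zeta (4 * p) = zeta p ^ m * (- \<i>)"
    by (simp add: complex_eq_iff)
  moreover have "zeta p ^ m * (- \<i>) \<in> int_adjoin {zeta p, \<i>}"
    by (intro int_adjoin_mult int_adjoin_power int_adjoin_uminus int_adjoin_incl) simp_all
  ultimately have "{zeta (4 * p)} \<subseteq> int_adjoin {zeta p, \<i>}"
    by simp
  moreover have "{zeta p, \<i>} \<subseteq> int_adjoin {zeta (4 * p)}"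
    using int_adjoin_power[OF int_adjoin_incl, of "zeta (4 * p)" "{zeta (4 * p)}"] z4 zp
    by (metis empty_subsetI insert_subset singletonI)
  ultimately have "int_adjoin {zeta p, \<i>} = int_adjoin {zeta (4 * p)}"
    by (meson int_adjoin_least subset_antisym)
  then show ?thesis using assms by (simp add: coeff_ring_def)
qed

end

theory Submission
  imports
    Defs
    "HOL-Number_Theory.Euler_Criterion"
    "Jordan_Normal_Form.Determinant"
begin

text \<open>
  Write \<open>r = (p - 1) / 2\<close>, \<open>\<O>\<close> for the coefficient ring, and \<open>\<sigma>\<close>, \<open>\<tau>\<close> for the two generating
  matrices. The representation is a sum of two pieces, and each of them preserves a free
  \<open>\<O>\<close>-lattice with an explicit basis.

  The small piece is spanned by \<open>1 - Z\<close>, \<open>X + X'\<close> and \<open>\<psi> (X - X')\<close>. The matrix \<open>\<sigma>\<close> swaps the first two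
  of these vectors and fixes the third; \<open>\<tau>\<close> fixes the first, sends the second to the third and the
  third to \<open>\<psi>\<^sup>2 = \<i>\<^sup>r\<close> times the second. That power of \<open>\<i>\<close> lies in \<open>\<O>\<close>, being a sign if \<open>r\<close> is even.

  The large piece is spanned by \<open>1 + Z, Y\<^sub>1, \<dots>, Y\<^sub>r\<close>. Reading \<open>1 + Z\<close> as the delta function \<open>\<delta>\<^sub>0\<close> on
  \<open>\<int>/p\<close> and \<open>2 Y\<^sub>j\<close> as \<open>\<delta>\<^sub>j + \<delta>\<^sub>-\<^sub>j\<close>, it becomes the space of even functions on \<open>\<int>/p\<close>, with \<open>\<sigma>\<close> the unitary
  Fourier transform and \<open>\<tau>\<close> the multiplication by the chirp \<open>\<zeta>\<^bsup>r j\<^sup>2\<^esup>\<close>: the even part of the Weil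
  representation. Its lattice is spanned by \<open>w\<^sub>k = \<tau>\<^sup>k \<sigma> \<delta>\<^sub>0\<close> for \<open>0 \<le> k \<le> r\<close>.
  The eigenvalues \<open>\<theta>\<^sub>0, \<dots>, \<theta>\<^sub>r\<close> of \<open>\<tau>\<close> are distinct, which makes these vectors a basis, and they
  are roots of a monic polynomial over \<open>\<O>\<close>, which puts every \<open>w\<^sub>k\<close> into the lattice
  (\<open>in_lattice_orbit\<close>). Hence \<open>\<tau>\<close> and its inverse preserve the lattice. For \<open>\<sigma>\<close> there are two cases.

  If \<open>p\<close> does not divide \<open>k\<close>, completing the square shows that \<open>\<sigma> w\<^sub>k\<close> is \<open>w\<close> at the residue
  \<open>- 1 / k\<close>, multiplied by a quadratic Gauss sum over \<open>\<surd>p\<close> (\<open>sigma_orbit\<close>). The square of the Gauss sum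
  is \<open>(-1)\<^sup>r p\<close> (\<open>gauss_square\<close>), so the factor is \<open>\<plusminus> \<i>\<^sup>r\<close> and belongs to \<open>\<O>\<close>; it is here, and in \<open>\<psi>\<^sup>2\<close>,
  that \<open>\<i>\<close> is needed when \<open>p \<equiv> 3\<close> modulo 4.

  If \<open>k = 0\<close>, then \<open>\<sigma> w\<^sub>0 = \<delta>\<^sub>0\<close>, and the claim is that \<open>\<delta>\<^sub>0\<close> is in the lattice. Lagrange interpolation
  at the eigenvalues writes \<open>\<delta>\<^sub>0\<close> in terms of the \<open>w\<^sub>k\<close> with the single denominator
  \<open>\<Prod>\<^sub>j (1 - \<theta>\<^sub>j) / \<surd>p\<close>. Up to a fourth root of unity, \<open>\<surd>p\<close> is the product of the \<open>r\<close> differences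
  \<open>\<zeta>\<^sup>j - \<zeta>\<^bsup>-j\<^esup>\<close> (\<open>half_product_square\<close>), and each of them is a multiple of \<open>1 - \<theta>\<^sub>j\<close> in \<open>\<int>[\<zeta>]\<close>, so that
  the denominator disappears (\<open>sqrt_p_quotient\<close>).
\<close>

section \<open>Lattices over subrings of the complex numbers\<close>

locale complex_subring =
  fixes R :: "complex set"
  assumes one_closed: "1 \<in> R"
    and add_closed: "a \<in> R \<Longrightarrow> b \<in> R \<Longrightarrow> a + b \<in> R"
    and mult_closed: "a \<in> R \<Longrightarrow> b \<in> R \<Longrightarrow> a * b \<in> R"
    and uminus_closed: "a \<in> R \<Longrightarrow> - a \<in> R"
begin

lemma zero_closed: "0 \<in> R"
  using add_closed[OF one_closed uminus_closed[OF one_closed]] by simp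

lemma diff_closed: "a \<in> R \<Longrightarrow> b \<in> R \<Longrightarrow> a - b \<in> R"
  using add_closed[of a "- b"] uminus_closed[of b] by simp

lemma power_closed: "a \<in> R \<Longrightarrow> a ^ n \<in> R"
  by (induction n) (auto intro: one_closed mult_closed)

lemma sum_closed: "(\<And>i. i \<in> I \<Longrightarrow> f i \<in> R) \<Longrightarrow> sum f I \<in> R"
  by (induction I rule: infinite_finite_induct) (auto intro: zero_closed add_closed)

lemma prod_closed: "(\<And>i. i \<in> I \<Longrightarrow> f i \<in> R) \<Longrightarrow> prod f I \<in> R"
  by (induction I rule: infinite_finite_induct) (auto intro: one_closed mult_closed)

definition poly_over :: "complex poly \<Rightarrow> bool" where
  "poly_over P \<longleftrightarrow> (\<forall>i. Polynomial.coeff P i \<in> R)"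

lemma poly_over_monom: "poly_over (Polynomial.monom 1 k)"
  by (simp add: poly_over_def one_closed zero_closed)

lemma poly_over_diff: "poly_over P \<Longrightarrow> poly_over Q \<Longrightarrow> poly_over (P - Q)"
  by (simp add: poly_over_def diff_closed)

lemma poly_over_smult: "c \<in> R \<Longrightarrow> poly_over P \<Longrightarrow> poly_over (Polynomial.smult c P)"
  by (simp add: poly_over_def mult_closed)

lemma poly_over_pCons: "c \<in> R \<Longrightarrow> poly_over P \<Longrightarrow> poly_over (pCons c P)"
  by (simp add: poly_over_def coeff_pCons split: nat.split)

lemma poly_over_mult: "poly_over P \<Longrightarrow> poly_over Q \<Longrightarrow> poly_over (P * Q)"
  by (simp add: poly_over_def coeff_mult sum_closed mult_closed)

lemma poly_over_1: "poly_over 1"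
  using poly_over_monom[of 0] by simp

lemma poly_over_linear_factor: "a \<in> R \<Longrightarrow> poly_over [:- a, 1:]"
  by (simp add: poly_over_pCons uminus_closed one_closed poly_over_def[of 0] zero_closed)

lemma poly_over_prod: "(\<And>i. i \<in> I \<Longrightarrow> poly_over (f i)) \<Longrightarrow> poly_over (prod f I)"
  by (induction I rule: infinite_finite_induct) (auto intro: poly_over_1 poly_over_mult)

definition lattice :: "complex mat \<Rightarrow> complex vec set" where
  "lattice W = {W *\<^sub>v c | c. c \<in> carrier_vec (dim_col W) \<and> (\<forall>i<dim_col W. vec_index c i \<in> R)}"

lemma lattice_zero: "W \<in> carrier_mat n n \<Longrightarrow> 0\<^sub>v n \<in> lattice W"
  unfolding lattice_def by (auto intro!: exI[of _ "0\<^sub>v n"] simp: zero_closed)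

lemma lattice_add:
  assumes "W \<in> carrier_mat n n" "v \<in> lattice W" "w \<in> lattice W"
  shows "v + w \<in> lattice W"
proof -
  obtain c d where "c \<in> carrier_vec n" "d \<in> carrier_vec n" "v = W *\<^sub>v c" "w = W *\<^sub>v d"
    and "\<forall>i<n. vec_index c i \<in> R" "\<forall>i<n. vec_index d i \<in> R"
    using assms unfolding lattice_def by auto
  then have "v + w = W *\<^sub>v (c + d)" "c + d \<in> carrier_vec n" "\<forall>i<n. vec_index (c + d) i \<in> R"
    using assms(1) by (auto simp: mult_add_distrib_mat_vec add_closed)
  then show ?thesis
    using assms(1) unfolding lattice_def by auto
qed

lemma lattice_smult:
  assumes "W \<in> carrier_mat n n" "a \<in> R" "v \<in> lattice W"
  shows "a \<cdot>\<^sub>v v \<in> lattice W"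
proof -
  obtain c where "c \<in> carrier_vec n" "v = W *\<^sub>v c" "\<forall>i<n. vec_index c i \<in> R"
    using assms unfolding lattice_def by auto
  then have "a \<cdot>\<^sub>v v = W *\<^sub>v (a \<cdot>\<^sub>v c)" "a \<cdot>\<^sub>v c \<in> carrier_vec n" "\<forall>i<n. vec_index (a \<cdot>\<^sub>v c) i \<in> R"
    using assms(1,2) by (auto simp: mult_mat_vec mult_closed)
  then show ?thesis
    using assms(1) unfolding lattice_def by auto
qed

lemma lattice_col:
  assumes "W \<in> carrier_mat n n" "k < n"
  shows "col W k \<in> lattice W"
proof -
  have "col W k = W *\<^sub>v unit_vec n k"
    using assms by (auto intro!: eq_vecI)
  moreover have "\<forall>i<n. vec_index (unit_vec n k) i \<in> R"
    using assms by (simp add: one_closed zero_closed)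
  ultimately show ?thesis
    using assms unfolding lattice_def by (auto intro!: exI[of _ "unit_vec n k"])
qed

text \<open>
  If the columns of \<open>W\<close> are a basis, this says that \<open>M\<close> maps the lattice spanned by them into
  itself: \<open>N\<close> is the matrix of \<open>M\<close> in that basis. Writing it without \<open>W\<close> inverted makes the
  closure under products immediate.
\<close>

definition integral_in :: "complex mat \<Rightarrow> nat \<Rightarrow> complex mat \<Rightarrow> bool" where
  "integral_in W n M \<longleftrightarrow> (\<exists>N \<in> carrier_mat n n. elements_mat N \<subseteq> R \<and> M * W = W * N)"

lemma lattice_factorisation:
  assumes W: "W \<in> carrier_mat n n" and A: "A \<in> carrier_mat n n"
    and cols: "\<And>k. k < n \<Longrightarrow> col A k \<in> lattice W"
  shows "\<exists>N \<in> carrier_mat n n. elements_mat N \<subseteq> R \<and> A = W * N"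
proof -
  have "\<exists>c. c \<in> carrier_vec n \<and> (\<forall>i<n. vec_index c i \<in> R) \<and> col A k = W *\<^sub>v c" if "k < n" for k
    using cols[OF that] W unfolding lattice_def by auto
  then obtain c where c: "\<And>k. k < n \<Longrightarrow> c k \<in> carrier_vec n"
      "\<And>k i. k < n \<Longrightarrow> i < n \<Longrightarrow> vec_index (c k) i \<in> R" "\<And>k. k < n \<Longrightarrow> col A k = W *\<^sub>v c k"
    by metis
  define N where "N = mat n n (\<lambda>(i, k). vec_index (c k) i)"
  have N: "N \<in> carrier_mat n n"
    by (simp add: N_def)
  have colN: "col N k = c k" if "k < n" for k
    using c(1)[OF that] that by (auto simp: N_def intro!: eq_vecI)
  have "A = W * N"
  proof (rule mat_col_eqI)
    fix k assume "k < dim_col (W * N)"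
    then have k: "k < n"
      using N by simp
    then show "col A k = col (W * N) k"
      using c(3)[OF k] col_mult2[OF W N k] colN[OF k] by simp
  qed (use W A N in auto)
  moreover have "elements_mat N \<subseteq> R"
    using c(2) by (auto simp: N_def)
  ultimately show ?thesis
    using N by blast
qed

lemma integral_inI:
  assumes W: "W \<in> carrier_mat n n" and M: "M \<in> carrier_mat n n"
    and cols: "\<And>k. k < n \<Longrightarrow> M *\<^sub>v col W k \<in> lattice W"
  shows "integral_in W n M"
  unfolding integral_in_def
proof (rule lattice_factorisation[OF W])
  show "M * W \<in> carrier_mat n n"
    using M W by simp
  show "col (M * W) k \<in> lattice W" if "k < n" for k
    using cols[OF that] col_mult2[OF M W that] by simp
qed

lemma integral_in_one: "W \<in> carrier_mat n n \<Longrightarrow> integral_in W n (1\<^sub>m n)"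
  unfolding integral_in_def
  by (rule bexI[of _ "1\<^sub>m n"]) (auto simp: one_closed zero_closed)

lemma integral_in_mult:
  assumes W: "W \<in> carrier_mat n n" and A: "A \<in> carrier_mat n n" and B: "B \<in> carrier_mat n n"
    and "integral_in W n A" "integral_in W n B"
  shows "integral_in W n (A * B)"
proof -
  obtain N N' where N: "N \<in> carrier_mat n n" "elements_mat N \<subseteq> R" "A * W = W * N"
    and N': "N' \<in> carrier_mat n n" "elements_mat N' \<subseteq> R" "B * W = W * N'"
    using assms unfolding integral_in_def by blast
  have "A * B * W = A * (W * N')"
    by (simp only: assoc_mult_mat[OF A B W] N'(3))
  also have "\<dots> = W * N * N'"
    by (simp only: assoc_mult_mat[OF A W N'(1), symmetric] N(3))
  also have "\<dots> = W * (N * N')"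
    by (rule assoc_mult_mat[OF W N(1) N'(1)])
  finally have "A * B * W = W * (N * N')" .
  moreover have "elements_mat (N * N') \<subseteq> R"
  proof
    fix x assume "x \<in> elements_mat (N * N')"
    then obtain i j where ij: "i < n" "j < n" "x = (N * N') $$ (i, j)"
      using N(1) N'(1) by auto
    have "N $$ (i, k) \<in> R" "N' $$ (k, j) \<in> R" if "k < n" for k
      using elements_matI[OF N(1) ij(1) that refl] elements_matI[OF N'(1) that ij(2) refl] N(2) N'(2)
      by auto
    then show "x \<in> R"
      using ij N(1) N'(1) by (auto simp: scalar_prod_def intro!: sum_closed mult_closed)
  qed
  ultimately show ?thesis
    using mult_carrier_mat[OF N(1) N'(1)] unfolding integral_in_def by blast
qed

lemma integral_in_conjugate:
  assumes W: "W \<in> carrier_mat n n" and V: "V \<in> carrier_mat n n" and M: "M \<in> carrier_mat n n"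
    and "V * W = 1\<^sub>m n" and "integral_in W n M"
  shows "elements_mat (V * M * W) \<subseteq> R"
proof -
  obtain N where N: "N \<in> carrier_mat n n" "elements_mat N \<subseteq> R" "M * W = W * N"
    using assms unfolding integral_in_def by blast
  have "V * M * W = V * W * N"
    by (simp only: assoc_mult_mat[OF V M W] assoc_mult_mat[OF V W N(1)] N(3))
  then show ?thesis
    using N(1,2) assms(4) by simp
qed

end

section \<open>Invertible matrices and interpolation\<close>

text \<open>
  Square matrices over a field have two-sided inverses as soon as they have one-sided ones, so a
  single product identifies both membership in the group and the inverse.
\<close>

lemma GL_inverse:
  assumes "A \<in> carrier_mat n n" "B \<in> carrier_mat n n" "A * B = 1\<^sub>m n"
  shows "A \<in> carrier (GL n)" "inv\<^bsub>GL n\<^esub> A = B"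
proof -
  have BA: "B * A = 1\<^sub>m n"
    using assms by (rule mat_mult_left_right_inverse)
  interpret R: ring "ring_mat TYPE(complex) n ()"
    by (rule ring_mat)
  have A: "A \<in> Units (ring_mat TYPE(complex) n ())" and B: "B \<in> Units (ring_mat TYPE(complex) n ())"
    using assms BA by (auto simp: Units_def ring_mat_simps)
  then show "A \<in> carrier (GL n)"
    by (simp add: GL_def units_of_carrier)
  interpret G: group "GL n"
    unfolding GL_def by (rule R.units_group)
  show "inv\<^bsub>GL n\<^esub> A = B"
    using A B BA
    by (intro G.inv_equality) (auto simp: GL_def units_of_carrier units_of_mult units_of_one ring_mat_simps)
qed

text \<open>
  Induction on the nodes in Newton's form: a new node is handled by adding a multiple of the
  product of the linear factors of the old ones.
\<close>

lemma interpolation: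
  fixes f :: "complex \<Rightarrow> complex"
  assumes "finite A"
  shows "\<exists>Q. Polynomial.degree Q \<le> card A - 1 \<and> (\<forall>x\<in>A. poly Q x = f x)"
  using assms
proof (induction A rule: finite_induct)
  case (insert x A)
  then obtain Q where Q: "Polynomial.degree Q \<le> card A - 1" "\<forall>y\<in>A. poly Q y = f y"
    by blast
  define P where "P = (\<Prod>a\<in>A. [:- a, 1:])"
  have P: "Polynomial.degree P = card A" "poly P x \<noteq> 0" "\<forall>y\<in>A. poly P y = 0"
    using insert by (auto simp: P_def poly_prod degree_prod_eq_sum_degree)
  define Q' where "Q' = Q + Polynomial.smult ((f x - poly Q x) / poly P x) P"
  have "Polynomial.degree Q' \<le> card (insert x A) - 1"
    using Q P insert unfolding Q'_def
    by (auto intro!: degree_add_le order_trans[OF degree_smult_le])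
  moreover have "\<forall>y\<in>insert x A. poly Q' y = f y"
    using Q P by (auto simp: Q'_def)
  ultimately show ?case
    by blast
qed (auto intro: exI[of _ 0])

section \<open>Sums over residues modulo an odd prime\<close>

locale odd_prime =
  fixes p :: nat
  assumes prime_p: "Factorial_Ring.prime p" and odd_p: "odd p"
begin

abbreviation e :: "int \<Rightarrow> complex" where "e n \<equiv> zeta p powi n"

lemma p_eq: "p = 2 * half p + 1"
  using odd_p by (auto simp: half_def elim!: oddE)

lemma p_gt_2: "p > 2"
  using prime_p odd_p by (metis even_numeral le_neq_implies_less prime_ge_2_nat)

lemma half_pos: "half p > 0"
  using p_eq p_gt_2 by linarith

lemma prime_int_p: "Factorial_Ring.prime (int p)"
  using prime_p by simp

lemma zeta_nonzero [simp]: "zeta p \<noteq> 0"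
  by (simp add: zeta_def)

lemma e_add: "e (a + b) = e a * e b"
  by (simp add: power_int_add)

lemma e_cis: "e n = cis (2 * pi * of_int n / of_nat p)"
proof -
  have "zeta p = cis (2 * pi / p)"
    by (simp add: zeta_def cis_conv_exp mult_ac)
  moreover have "cis (2 * pi / p) powi n = cis (of_int n * (2 * pi / p))"
    by (metis cis_power_int)
  ultimately show ?thesis
    by (simp add: mult_ac)
qed

lemma e_eq_1_iff: "e n = 1 \<longleftrightarrow> int p dvd n"
proof
  assume "e n = 1"
  then have "cos (2 * pi * of_int n / of_nat p) = 1"
    by (auto simp: e_cis complex_eq_iff)
  then obtain m :: int where "2 * pi * of_int n / of_nat p = of_int m * 2 * pi"
    using cos_one_2pi_int by auto
  then have "real_of_int n = real_of_int (m * int p)"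
    using p_gt_2 by (simp add: field_simps)
  then show "int p dvd n"
    by (simp only: of_int_eq_iff) simp
next
  assume "int p dvd n"
  then obtain m where "n = int p * m" ..
  then have "2 * pi * of_int n / of_nat p = 2 * pi * of_int m"
    using p_gt_2 by simp
  then show "e n = 1"
    by (simp only: e_cis) simp
qed

lemma e_cong:
  assumes "[a = b] (mod int p)"
  shows "e a = e b"
proof -
  have "e (a - b) = 1"
    using assms by (simp add: e_eq_1_iff cong_iff_dvd_diff)
  then show ?thesis
    using e_add[of "a - b" b] by simp
qed

lemma e_mod [simp]: "e (n mod int p) = e n"
  by (rule e_cong) simp

lemma sum_residues_reindex:
  fixes F :: "int \<Rightarrow> complex"
  assumes periodic: "\<And>a b. [a = b] (mod int p) \<Longrightarrow> F a = F b"
    and inj: "\<And>a b. a \<in> {0..<int p} \<Longrightarrow> b \<in> {0..<int p} \<Longrightarrow> [g a = g b] (mod int p) \<Longrightarrow> a = b"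
  shows "(\<Sum>j\<in>{0..<int p}. F (g j)) = (\<Sum>j\<in>{0..<int p}. F j)"
proof -
  let ?h = "\<lambda>j. g j mod int p"
  have p0: "int p > 0"
    using p_gt_2 by simp
  have "inj_on ?h {0..<int p}"
    by (rule inj_onI) (simp only: inj cong_def)
  moreover have "?h ` {0..<int p} \<subseteq> {0..<int p}"
    using p0 by auto
  ultimately have "bij_betw ?h {0..<int p} {0..<int p}"
    by (simp add: bij_betw_def endo_inj_surj)
  then have "(\<Sum>j\<in>{0..<int p}. F (?h j)) = (\<Sum>j\<in>{0..<int p}. F j)"
    by (rule sum.reindex_bij_betw)
  moreover have "F (?h j) = F (g j)" for j
    by (rule periodic) simp
  ultimately show ?thesis
    by simp
qed

lemma residue_eqI:
  assumes "a \<in> {0..<int p}" "b \<in> {0..<int p}" "[a = b] (mod int p)"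
  shows "a = b"
  using assms by (simp add: cong_def)

lemma cong_cancel:
  assumes "\<not> int p dvd c" "[c * a = c * b] (mod int p)"
  shows "[a = b] (mod int p)"
  using assms prime_int_p
  by (metis cong_mult_lcancel coprime_commute prime_imp_coprime)

lemma sum_residues_shift:
  fixes F :: "int \<Rightarrow> complex"
  assumes "\<And>a b. [a = b] (mod int p) \<Longrightarrow> F a = F b"
  shows "(\<Sum>j\<in>{0..<int p}. F (j + s)) = (\<Sum>j\<in>{0..<int p}. F j)"
  by (rule sum_residues_reindex[OF assms]) (simp_all only: residue_eqI cong_add_rcancel)

lemma sum_residues_scale:
  fixes F :: "int \<Rightarrow> complex"
  assumes "\<And>a b. [a = b] (mod int p) \<Longrightarrow> F a = F b" and "\<not> int p dvd c"
  shows "(\<Sum>j\<in>{0..<int p}. F (c * j)) = (\<Sum>j\<in>{0..<int p}. F j)"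
proof (rule sum_residues_reindex[OF assms(1)])
  fix a b assume "a \<in> {0..<int p}" "b \<in> {0..<int p}" "[c * a = c * b] (mod int p)"
  then show "a = b"
    using residue_eqI cong_cancel[OF assms(2)] by blast
qed

text \<open>
  Sums over all residues are invariant under reindexing, while the representation is indexed by
  the half system \<open>1, \<dots>, r\<close>; this identity passes from one to the other.
\<close>

lemma sum_residues_symmetric:
  fixes F :: "int \<Rightarrow> complex"
  assumes "\<And>a b. [a = b] (mod int p) \<Longrightarrow> F a = F b"
  shows "(\<Sum>j\<in>{0..<int p}. F j) = F 0 + (\<Sum>j=1..half p. F (int j) + F (- int j))"
proof -
  have "(\<Sum>j\<in>{0..<int p}. F j) = (\<Sum>j<p. F (int j))"
    by (rule sum.reindex_bij_witness[of _ int nat]) auto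
  also have "{..<p} = insert 0 ({1..half p} \<union> {half p + 1..2 * half p})"
    using p_eq by auto
  also have "(\<Sum>j\<in>\<dots>. F (int j)) =
      F 0 + (\<Sum>j=1..half p. F (int j)) + (\<Sum>j=half p + 1..2 * half p. F (int j))"
    by (subst sum.insert) (auto simp: sum.union_disjoint)
  also have "(\<Sum>j=half p + 1..2 * half p. F (int j)) = (\<Sum>j=1..half p. F (- int j))"
  proof (rule sum.reindex_bij_witness[of _ "\<lambda>j. p - j" "\<lambda>j. p - j"], goal_cases)
    case (5 j)
    then have "- int (p - j) = int j - int p"
      using p_eq by (simp add: of_nat_diff)
    then show ?case
      by (intro assms) (simp add: cong_iff_dvd_diff)
  qed (use p_eq in auto)
  finally show ?thesis
    by (simp add: sum.distrib)
qed

lemma sum_e: "(\<Sum>j\<in>{0..<int p}. e (m * j)) = (if int p dvd m then of_nat p else 0)"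
proof (cases "int p dvd m")
  case True
  then have "e (m * j) = 1" for j
    by (simp add: e_eq_1_iff)
  then show ?thesis
    using True by simp
next
  case False
  let ?S = "\<Sum>j\<in>{0..<int p}. e (m * j)"
  have "?S = (\<Sum>j\<in>{0..<int p}. e (m * (j + 1)))"
    by (rule sum_residues_shift[symmetric]) (auto intro!: e_cong cong_scalar_left)
  also have "\<dots> = e m * ?S"
    by (simp add: distrib_left e_add sum_distrib_left mult_ac)
  finally have "(e m - 1) * ?S = 0"
    by (simp add: algebra_simps)
  then show ?thesis
    using False by (simp add: e_eq_1_iff)
qed

section \<open>Quadratic Gauss sums\<close>

definition gauss :: "int \<Rightarrow> complex" where
  "gauss a = (\<Sum>j\<in>{0..<int p}. e (a * j\<^sup>2))"

lemma two_half_cong: "[2 * int (half p) = - 1] (mod int p)"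
proof -
  have "2 * int (half p) = int p - 1"
    using p_eq by linarith
  then show ?thesis
    by (simp add: cong_iff_dvd_diff)
qed

text \<open>
  Since \<open>2 r = - 1\<close> modulo \<open>p\<close>, the exponent is \<open>r k (j + k' m)\<^sup>2 + r k' m\<^sup>2\<close> modulo \<open>p\<close>, and the shift
  of \<open>j\<close> does not change the sum. In terms of the representation: the Fourier transform of a chirp
  is again a chirp.
\<close>

lemma gauss_complete_square:
  fixes k k' m :: int
  assumes kk': "[k * k' = - 1] (mod int p)"
  shows "(\<Sum>j\<in>{0..<int p}. e (int (half p) * k * j\<^sup>2 + m * j)) =
           gauss (int (half p) * k) * e (int (half p) * k' * m\<^sup>2)"
proof -
  let ?r = "int (half p)"
  have step: "e (?r * k * j\<^sup>2 + m * j) = e (?r * k * (j + k' * m)\<^sup>2) * e (?r * k' * m\<^sup>2)" for j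
  proof -
    obtain u where u: "k * k' + 1 = int p * u"
      using kk' by (auto simp: cong_iff_dvd_diff)
    obtain v where v: "2 * ?r + 1 = int p * v"
      using two_half_cong by (auto simp: cong_iff_dvd_diff)
    have "?r * k * j\<^sup>2 + m * j - (?r * k * (j + k' * m)\<^sup>2 + ?r * k' * m\<^sup>2)
        = (2 * ?r + 1) * (m * j) - (k * k' + 1) * (2 * ?r * m * j + ?r * k' * m\<^sup>2)"
      by (simp add: algebra_simps power2_eq_square)
    also have "\<dots> = int p * (v * (m * j) - u * (2 * ?r * m * j + ?r * k' * m\<^sup>2))"
      unfolding u v by (simp add: algebra_simps)
    finally have "[?r * k * j\<^sup>2 + m * j = ?r * k * (j + k' * m)\<^sup>2 + ?r * k' * m\<^sup>2] (mod int p)"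
      by (simp add: cong_iff_dvd_diff)
    then show ?thesis
      unfolding e_add[symmetric] by (rule e_cong)
  qed
  have "(\<Sum>j\<in>{0..<int p}. e (?r * k * (j + k' * m)\<^sup>2)) = gauss (?r * k)"
    unfolding gauss_def
    by (rule sum_residues_shift[where F = "\<lambda>j. e (?r * k * j\<^sup>2)"])
      (auto intro!: e_cong cong_scalar_left cong_pow)
  then show ?thesis
    by (simp add: step sum_distrib_right[symmetric])
qed

text \<open>
  Summing the completed square over \<open>m\<close> inverts the Fourier transform, which leaves \<open>p\<close> times the
  value of the original chirp at \<open>0\<close>.
\<close>

lemma gauss_mult_gauss:
  assumes kk': "[k * k' = - 1] (mod int p)"
  shows "gauss (int (half p) * k) * gauss (int (half p) * k') = of_nat p"
proof -
  let ?r = "int (half p)"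
  have "gauss (?r * k) * gauss (?r * k') =
      (\<Sum>m\<in>{0..<int p}. \<Sum>j\<in>{0..<int p}. e (?r * k * j\<^sup>2 + m * j))"
    unfolding gauss_complete_square[OF kk'] gauss_def[of "?r * k'"] sum_distrib_left ..
  also have "\<dots> = (\<Sum>j\<in>{0..<int p}. e (?r * k * j\<^sup>2) * (\<Sum>m\<in>{0..<int p}. e (j * m)))"
    by (subst sum.swap) (simp add: e_add sum_distrib_left sum_distrib_right mult_ac)
  also have "\<dots> = (\<Sum>j\<in>{0..<int p}. if j = 0 then of_nat p else 0)"
  proof (rule sum.cong)
    fix j assume j: "j \<in> {0..<int p}"
    then have "int p dvd j \<longleftrightarrow> j = 0"
      using zdvd_imp_le[of "int p" j] by fastforce
    then show "e (?r * k * j\<^sup>2) * (\<Sum>m\<in>{0..<int p}. e (j * m)) = (if j = 0 then of_nat p else 0)"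
      by (simp add: sum_e)
  qed simp
  also have "\<dots> = of_nat p"
    using p_gt_2 by (simp add: sum.delta)
  finally show ?thesis .
qed

lemma minus_one_square:
  assumes "even (half p)"
  obtains c where "[c\<^sup>2 = - 1] (mod int p)"
proof -
  have "[Legendre (- 1) (int p) = 1] (mod int p)"
    using euler_criterion[OF prime_p p_gt_2, of "- 1"] assms by (simp add: half_def)
  moreover have "\<not> [- 1 = (1::int)] (mod int p)"
    using p_gt_2 zdvd_imp_le[of "int p" 2] by (auto simp: cong_iff_dvd_diff)
  moreover have "\<not> [0 = (1::int)] (mod int p)"
    using p_gt_2 by (auto simp: cong_iff_dvd_diff)
  ultimately have "QuadRes (int p) (- 1)"
    by (auto simp: Legendre_def split: if_splits)
  then show ?thesis
    using that by (auto simp: QuadRes_def)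
qed

lemma minus_one_not_square:
  assumes "odd (half p)"
  shows "\<not> [c\<^sup>2 = - 1] (mod int p)"
proof
  assume c: "[c\<^sup>2 = - 1] (mod int p)"
  then have "QuadRes (int p) (- 1)"
    by (auto simp: QuadRes_def)
  moreover have n0: "\<not> [- 1 = (0::int)] (mod int p)"
    using p_gt_2 by (auto simp: cong_iff_dvd_diff)
  ultimately have "Legendre (- 1) (int p) = 1"
    by (simp add: Legendre_def)
  then have "[1 = - (1::int)] (mod int p)"
    using euler_criterion[OF prime_p p_gt_2, of "- 1"] assms by (simp add: half_def)
  then show False
    using p_gt_2 zdvd_imp_le[of "int p" 2] by (auto simp: cong_iff_dvd_diff)
qed

lemma cong_squares:
  assumes "[a\<^sup>2 = b\<^sup>2] (mod int p)"
  shows "[a = b] (mod int p) \<or> [a = - b] (mod int p)"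
proof -
  have "int p dvd (a - b) * (a + b)"
    using assms by (simp add: cong_iff_dvd_diff power2_eq_square algebra_simps)
  then show ?thesis
    using prime_int_p by (simp add: prime_dvd_mult_iff cong_iff_dvd_diff)
qed

lemma gauss_symmetric: "gauss a = 1 + 2 * (\<Sum>j=1..half p. e (a * (int j)\<^sup>2))"
  unfolding gauss_def
  by (subst sum_residues_symmetric) (auto intro!: e_cong cong_scalar_left cong_pow simp: sum.distrib sum_distrib_left)

text \<open>
  If \<open>r\<close> is even then \<open>- 1 = c\<^sup>2\<close> modulo \<open>p\<close>, and replacing \<open>j\<close> by \<open>c j\<close> turns one sum into the other. If
  \<open>r\<close> is odd then \<open>- 1\<close> is not a square, so the squares and their negatives together run through all
  residues, and the two Gauss sums add up to twice the vanishing sum of all \<open>p\<close>-th roots of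
  unity.
\<close>

lemma gauss_uminus:
  assumes a: "\<not> int p dvd a"
  shows "gauss (- a) = (-1) ^ half p * gauss a"
proof (cases "even (half p)")
  case True
  then obtain c where c: "[c\<^sup>2 = - 1] (mod int p)"
    by (rule minus_one_square)
  have pc: "\<not> int p dvd c"
  proof
    assume "int p dvd c"
    then have "[c = 0] (mod int p)"
      by (simp add: cong_0_iff)
    from cong_trans[OF cong_sym[OF c] cong_pow[OF this, of 2]] have "[- 1 = (0::int)] (mod int p)"
      by simp
    then show False
      using p_gt_2 by (auto simp: cong_iff_dvd_diff)
  qed
  have "gauss a = (\<Sum>j\<in>{0..<int p}. e (a * (c * j)\<^sup>2))"
    unfolding gauss_def
    by (rule sum_residues_scale[symmetric, where F = "\<lambda>j. e (a * j\<^sup>2)"])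
      (use pc in \<open>auto intro!: e_cong cong_scalar_left cong_pow\<close>)
  also have "\<dots> = gauss (- a)"
    unfolding gauss_def
  proof (intro sum.cong refl e_cong)
    fix j
    have "[c\<^sup>2 * (a * j\<^sup>2) = - 1 * (a * j\<^sup>2)] (mod int p)"
      by (intro cong_scalar_right c)
    then show "[a * (c * j)\<^sup>2 = - a * j\<^sup>2] (mod int p)"
      by (simp add: power_mult_distrib mult_ac)
  qed
  finally show ?thesis
    using True by simp
next
  case False
  \<comment> \<open>The map \<open>?g\<close> is a permutation of the residues modulo \<open>p\<close>: squares on the lower half,
    negatives of squares on the upper half.\<close>
  let ?g = "\<lambda>j. if j \<le> int (half p) then j\<^sup>2 else - j\<^sup>2"
  have sqeq: "i = j"
    if ij: "i \<in> {0..<int p}" "j \<in> {0..<int p}" "[i\<^sup>2 = j\<^sup>2] (mod int p)"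
      and side: "i \<le> int (half p) \<longleftrightarrow> j \<le> int (half p)" for i j
    using cong_squares[OF ij(3)]
  proof
    assume "[i = - j] (mod int p)"
    then have "int p dvd i + j"
      by (simp add: cong_iff_dvd_diff)
    then obtain q where q: "i + j = int p * q" ..
    have pe: "int p = 2 * int (half p) + 1"
      using p_eq by linarith
    show ?thesis
    proof (cases "i \<le> int (half p)")
      case True
      then have "int p * q < int p * 1" "int p * q \<ge> 0"
        using ij side pe unfolding q[symmetric] by auto
      then have "q = 0"
        using p_gt_2 by (simp add: zero_le_mult_iff)
      then show ?thesis
        using q ij by simp
    next
      case False
      then have "int p * q > int p * 1" "int p * q < int p * 2"
        using ij side pe unfolding q[symmetric] by auto
      then have False
        using p_gt_2 by (simp only: mult_less_cancel_left) auto
      then show ?thesis ..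
    qed
  qed (use ij residue_eqI in blast)
  have mixed: False
    if ij: "i \<in> {0..<int p}" "j \<in> {0..<int p}" "[i\<^sup>2 = - j\<^sup>2] (mod int p)" "j > int (half p)" for i j
  proof -
    have "\<not> int p dvd j"
      using ij zdvd_imp_le[of "int p" j] by auto
    then have "coprime j (int p)"
      using prime_int_p by (metis coprime_commute prime_imp_coprime)
    then obtain t where t: "[j * t = 1] (mod int p)"
      using cong_solve_coprime_int by blast
    have "[i\<^sup>2 * t\<^sup>2 = - j\<^sup>2 * t\<^sup>2] (mod int p)"
      by (intro cong_scalar_right ij)
    moreover have "[- ((j * t)\<^sup>2) = - (1\<^sup>2)] (mod int p)"
      by (intro cong_pow t iffD2[OF cong_minus_minus_iff])
    ultimately have "[(i * t)\<^sup>2 = - 1] (mod int p)"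
      by (metis cong_trans mult_minus_left one_power2 power_mult_distrib)
    then show False
      using minus_one_not_square[OF False] by blast
  qed
  have inj: "i = j" if ij: "i \<in> {0..<int p}" "j \<in> {0..<int p}" "[?g i = ?g j] (mod int p)" for i j
  proof -
    consider "i \<le> int (half p) \<longleftrightarrow> j \<le> int (half p)" | "i \<le> int (half p)" "\<not> j \<le> int (half p)"
      | "\<not> i \<le> int (half p)" "j \<le> int (half p)" by blast
    then show ?thesis
    proof cases
      case 1
      then show ?thesis
        using sqeq[OF ij(1,2) _ 1] ij(3) by (auto simp: cong_minus_minus_iff split: if_splits)
    next
      case 2
      then show ?thesis
        using mixed[OF ij(1,2)] ij(3) by auto
    next
      case 3
      then show ?thesis
        using mixed[OF ij(2,1)] ij(3) by (auto simp: cong_sym_eq)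
    qed
  qed
  have "(\<Sum>j\<in>{0..<int p}. e (a * ?g j)) = (\<Sum>j\<in>{0..<int p}. e (a * j))"
    by (rule sum_residues_reindex[where F = "\<lambda>j. e (a * j)"])
      (simp_all only: inj e_cong cong_scalar_left)
  also have "\<dots> = 0"
    using a by (simp add: sum_e)
  also have "(\<Sum>j\<in>{0..<int p}. e (a * ?g j)) = (\<Sum>j<p. e (a * ?g (int j)))"
    by (rule sum.reindex_bij_witness[of _ int nat]) auto
  also have "{..<p} = insert 0 ({1..half p} \<union> {half p + 1..2 * half p})"
    using p_eq by auto
  also have "(\<Sum>j\<in>\<dots>. e (a * ?g (int j))) =
      1 + (\<Sum>j=1..half p. e (a * ?g (int j))) + (\<Sum>j=half p + 1..2 * half p. e (a * ?g (int j)))"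
    by (subst sum.insert) (auto simp: sum.union_disjoint)
  also have "(\<Sum>j=1..half p. e (a * ?g (int j))) = (\<Sum>j=1..half p. e (a * (int j)\<^sup>2))"
    by (rule sum.cong) auto
  also have "(\<Sum>j=half p + 1..2 * half p. e (a * ?g (int j))) = (\<Sum>j=1..half p. e (- a * (int j)\<^sup>2))"
  proof (rule sum.reindex_bij_witness[of _ "\<lambda>j. p - j" "\<lambda>j. p - j"], goal_cases)
    case (5 j)
    then have pj: "int (p - j) = int p - int j"
      using p_eq by (simp add: of_nat_diff)
    have "[- int (p - j) = int j] (mod int p)"
      unfolding pj by (simp add: cong_iff_dvd_diff)
    then have "[(- int (p - j))\<^sup>2 = (int j)\<^sup>2] (mod int p)"
      by (rule cong_pow)
    then have "[- a * (int (p - j))\<^sup>2 = - a * (int j)\<^sup>2] (mod int p)"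
      by (intro cong_scalar_left) simp
    then have "e (- a * (int (p - j))\<^sup>2) = e (- a * (int j)\<^sup>2)"
      by (rule e_cong)
    then show ?case
      using 5 by simp
  qed (use p_eq in auto)
  finally have "1 + (\<Sum>j=1..half p. e (a * (int j)\<^sup>2)) + (\<Sum>j=1..half p. e (- a * (int j)\<^sup>2)) = 0" .
  then have "2 * (1 + (\<Sum>j=1..half p. e (a * (int j)\<^sup>2)) + (\<Sum>j=1..half p. e (- a * (int j)\<^sup>2))) = 0"
    by simp
  then have "gauss a + gauss (- a) = 0"
    unfolding gauss_symmetric by (simp add: distrib_left add.assoc)
  then show ?thesis
    using False by (simp add: add_eq_0_iff)
qed

text \<open>
  With \<open>k' = - 1 / k\<close> the residue \<open>k'\<close> is \<open>- k\<close> times the square of \<open>1 / k\<close>, so that the Gauss sums at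
  \<open>r k'\<close> and at \<open>- r k\<close> agree; this turns the product formula into one for the square.
\<close>

lemma gauss_square:
  assumes k: "\<not> int p dvd k"
  shows "(gauss (int (half p) * k))\<^sup>2 = (-1) ^ half p * of_nat p"
proof -
  let ?r = "int (half p)"
  have "coprime k (int p)"
    using k prime_int_p by (metis coprime_commute prime_imp_coprime)
  then obtain t where t: "[k * t = 1] (mod int p)"
    using cong_solve_coprime_int by blast
  have kt: "[k * (- t) = - 1] (mod int p)"
    using cong_minus_minus_iff[of "k * t" 1 "int p"] t by simp
  have "\<not> int p dvd t"
  proof
    assume "int p dvd t"
    then have "int p dvd 1"
      using t by (metis cong_dvd_iff dvd_mult)
    then show False
      using p_gt_2 by auto
  qed
  then have "gauss (?r * - t) = (\<Sum>j\<in>{0..<int p}. e (?r * - t * (k * j)\<^sup>2))"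
    unfolding gauss_def
    by (intro sum_residues_scale[symmetric, where F = "\<lambda>j. e (?r * - t * j\<^sup>2)"])
      (use k in \<open>simp_all only: e_cong cong_scalar_left cong_pow simp_thms\<close>)
  also have "\<dots> = gauss (- (?r * k))"
    unfolding gauss_def
  proof (intro sum.cong refl e_cong)
    fix j
    have "[k * t * (- ?r * k * j\<^sup>2) = 1 * (- ?r * k * j\<^sup>2)] (mod int p)"
      by (intro cong_scalar_right t)
    then show "[?r * - t * (k * j)\<^sup>2 = - (?r * k) * j\<^sup>2] (mod int p)"
      by (simp add: power2_eq_square mult_ac)
  qed
  also have "\<not> int p dvd ?r"
    using half_pos p_eq zdvd_imp_le[of "int p" ?r] by auto
  then have "\<not> int p dvd ?r * k"
    using k prime_int_p by (simp add: prime_dvd_mult_iff)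
  then have "gauss (- (?r * k)) = (-1) ^ half p * gauss (?r * k)"
    by (rule gauss_uminus)
  finally have "gauss (?r * k) * ((-1) ^ half p * gauss (?r * k)) = of_nat p"
    using gauss_mult_gauss[OF kt] by simp
  then have "(-1) ^ half p * ((-1) ^ half p * (gauss (?r * k))\<^sup>2) = (-1) ^ half p * of_nat p"
    by (simp add: power2_eq_square mult_ac)
  then show ?thesis
    by (simp add: mult.assoc[symmetric] power_add[symmetric] mult_2[symmetric] power_mult)
qed

section \<open>A half system of factors of the prime\<close>

text \<open>
  The cyclotomic polynomial \<open>1 + x + \<dots> + x\<^bsup>p - 1\<^esup>\<close> evaluated at \<open>x = 1\<close>.
\<close>

lemma prod_one_minus_e: "(\<Prod>j=1..<p. 1 - e (int j)) = of_nat p"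
proof -
  let ?P = "(\<Sum>i<p. Polynomial.monom (1::complex) i)"
  let ?Q = "(\<Prod>j=1..<p. [:- e (int j), 1:])"
  let ?A = "(\<lambda>j. e (int j)) ` {1..<p}"
  have inj: "inj_on (\<lambda>j. e (int j)) {1..<p}"
  proof (rule inj_onI)
    fix i j assume ij: "i \<in> {1..<p}" "j \<in> {1..<p}" "e (int i) = e (int j)"
    then have "e (int i - int j) = 1"
      by (simp add: power_int_diff)
    then have "[int i = int j] (mod int p)"
      by (simp add: e_eq_1_iff cong_iff_dvd_diff)
    then show "i = j"
      using residue_eqI[of "int i" "int j"] ij by simp
  qed
  have "?P = ?Q"
  proof (rule poly_eqI_degree_lead_coeff)
    show "card ?A \<ge> p - 1"
      by (simp only: card_image[OF inj]) simp
    show "Polynomial.degree ?P \<le> p - 1"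
    proof (rule degree_sum_le)
      fix i assume "i \<in> {..<p}"
      then show "Polynomial.degree (Polynomial.monom (1::complex) i) \<le> p - 1"
        by (simp add: degree_monom_eq)
    qed simp
    have dQ: "Polynomial.degree ?Q = p - 1"
      by (subst degree_prod_eq_sum_degree) auto
    then show "Polynomial.degree ?Q \<le> p - 1"
      by simp
    have "Polynomial.coeff ?Q (p - 1) = 1"
      using lead_coeff_prod[of "\<lambda>j. [:- e (int j), 1:]" "{1..<p}"] dQ by simp
    moreover have "Polynomial.coeff ?P (p - 1) = 1"
      using p_gt_2 by (simp add: coeff_sum sum.delta)
    ultimately show "Polynomial.coeff ?P (p - 1) = Polynomial.coeff ?Q (p - 1)"
      by simp
  next
    fix x assume "x \<in> ?A"
    then obtain j where j: "j \<in> {1..<p}" "x = e (int j)" by auto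
    have "\<not> int p dvd int j"
      using j zdvd_imp_le[of "int p" "int j"] by auto
    then have x1: "x \<noteq> 1"
      by (simp only: j(2) e_eq_1_iff not_False_eq_True)
    have "x ^ p = e (int j * int p)"
      using j(2) by (simp only: power_int_mult power_int_of_nat)
    also have "\<dots> = 1"
      by (simp add: e_eq_1_iff)
    finally have "(\<Sum>i<p. x ^ i) = 0"
      using x1 by (simp add: geometric_sum)
    moreover have "poly ?Q x = 0"
      unfolding poly_prod using j by (intro prod_zero) auto
    ultimately show "poly ?P x = poly ?Q x"
      by (simp add: poly_sum poly_monom)
  qed
  from arg_cong[OF this, of "\<lambda>f. poly f 1"] show ?thesis
    by (simp add: poly_sum poly_monom poly_prod)
qed

text \<open>
  This is \<open>\<plusminus> \<i>\<^sup>r \<surd>p\<close>. It plays the role of the square root of \<open>p\<close> because its divisibility properties in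
  \<open>\<int>[\<zeta>]\<close> can be read off factor by factor.
\<close>

definition half_product :: complex where
  "half_product = (\<Prod>j=1..half p. e (int j) - e (- int j))"

text \<open>
  Each \<open>- (\<zeta>\<^sup>j - \<zeta>\<^bsup>-j\<^esup>)\<^sup>2\<close> is \<open>(1 - \<zeta>\<^bsup>2j\<^esup>) (1 - \<zeta>\<^bsup>-2j\<^esup>)\<close>, and the residues \<open>\<plusminus> 2j\<close> exhaust the nonzero ones.
\<close>

lemma half_product_square: "half_product\<^sup>2 = (-1) ^ half p * of_nat p"
proof -
  \<comment> \<open>The even residues \<open>2, 4, \<dots>, 2r\<close> and the odd ones \<open>p - 2, p - 4, \<dots>, p - 2r\<close>
    exhaust \<open>1, \<dots>, p - 1\<close>.\<close>
  have "(\<Prod>j=1..<p. 1 - e (int j)) =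
      (\<Prod>j\<in>(\<lambda>j. 2 * j) ` {1..half p} \<union> (\<lambda>j. p - 2 * j) ` {1..half p}. 1 - e (int j))"
  proof (intro prod.cong refl equalityI subsetI)
    fix m assume m: "m \<in> {1..<p}"
    show "m \<in> (\<lambda>j. 2 * j) ` {1..half p} \<union> (\<lambda>j. p - 2 * j) ` {1..half p}"
    proof (cases "even m")
      case True
      then have "m = 2 * (m div 2)" "1 \<le> m div 2" "m div 2 \<le> half p"
        using m p_eq unfolding atLeastLessThan_iff by presburger+
      then have "m = 2 * (m div 2)" "m div 2 \<in> {1..half p}"
        by auto
      then show ?thesis by blast
    next
      case False
      then have "m = p - 2 * ((p - m) div 2)" "1 \<le> (p - m) div 2" "(p - m) div 2 \<le> half p"
        using m p_eq unfolding atLeastLessThan_iff by presburger+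
      then have "m = p - 2 * ((p - m) div 2)" "(p - m) div 2 \<in> {1..half p}"
        by simp_all
      then show ?thesis by blast
    qed
  next
    fix m assume "m \<in> (\<lambda>j. 2 * j) ` {1..half p} \<union> (\<lambda>j. p - 2 * j) ` {1..half p}"
    then obtain j where "1 \<le> j" "j \<le> half p" "m = 2 * j \<or> m = p - 2 * j"
      by auto
    then have "1 \<le> m" "m < p"
      using p_eq by linarith+
    then show "m \<in> {1..<p}"
      by simp
  qed
  also have "\<dots> = (\<Prod>j\<in>(\<lambda>j. 2 * j) ` {1..half p}. 1 - e (int j)) *
      (\<Prod>j\<in>(\<lambda>j. p - 2 * j) ` {1..half p}. 1 - e (int j))"
  proof (rule prod.union_disjoint)
    have "2 * i \<noteq> p - 2 * j" if "j \<le> half p" for i j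
      using p_eq that by presburger
    then show "(\<lambda>j. 2 * j) ` {1..half p} \<inter> (\<lambda>j. p - 2 * j) ` {1..half p} = {}"
      by auto
  qed auto
  also have "(\<Prod>j\<in>(\<lambda>j. 2 * j) ` {1..half p}. 1 - e (int j)) = (\<Prod>j=1..half p. 1 - e (2 * int j))"
    by (subst prod.reindex) (simp_all add: inj_on_def del: power_int_of_nat)
  also have "(\<Prod>j\<in>(\<lambda>j. p - 2 * j) ` {1..half p}. 1 - e (int j)) = (\<Prod>j=1..half p. 1 - e (- (2 * int j)))"
  proof (subst prod.reindex)
    show "inj_on (\<lambda>j. p - 2 * j) {1..half p}"
    proof (rule inj_onI)
      fix i j assume "i \<in> {1..half p}" "j \<in> {1..half p}" "p - 2 * i = p - 2 * j"
      then show "i = j"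
        unfolding atLeastAtMost_iff using p_eq by linarith
    qed
    have "e (int (p - 2 * j)) = e (- (2 * int j))" if "j \<in> {1..half p}" for j
    proof (rule e_cong)
      have "int (p - 2 * j) = int p - 2 * int j"
        using p_eq that by (simp add: of_nat_diff)
      then show "[int (p - 2 * j) = - (2 * int j)] (mod int p)"
        by (simp add: cong_iff_dvd_diff)
    qed
    then show "prod ((\<lambda>j. 1 - e (int j)) \<circ> (\<lambda>j. p - 2 * j)) {1..half p} =
        (\<Prod>j=1..half p. 1 - e (- (2 * int j)))"
      by simp
  qed
  finally have "of_nat p = (\<Prod>j=1..half p. (1 - e (2 * int j)) * (1 - e (- (2 * int j))))"
    by (simp only: prod_one_minus_e prod.distrib)
  also have "\<dots> = (\<Prod>j=1..half p. - ((e (int j) - e (- int j))\<^sup>2))"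
  proof (rule prod.cong)
    fix j
    have "e (int j) * e (- int j) = 1"
      unfolding e_add[symmetric] by simp
    moreover have "e (2 * int j) = e (int j) * e (int j)" "e (- (2 * int j)) = e (- int j) * e (- int j)"
      unfolding e_add[symmetric] by simp_all
    moreover have "(1 - x * x) * (1 - y * y) = - ((x - y)\<^sup>2)" if "x * y = 1" for x y :: complex
    proof -
      have "(1 - x * x) * (1 - y * y) = 1 - x * x - y * y + (x * y) * (x * y)"
        by (simp add: algebra_simps)
      then show ?thesis
        using that by (simp add: algebra_simps power2_eq_square)
    qed
    ultimately show "(1 - e (2 * int j)) * (1 - e (- (2 * int j))) = - ((e (int j) - e (- int j))\<^sup>2)"
      by simp
  qed simp
  also have "\<dots> = (-1) ^ half p * half_product\<^sup>2"
    by (simp only: half_product_def prod_power_distrib[symmetric] prod_uminus) simp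
  finally have "(-1) ^ half p * of_nat p = (-1) ^ half p * ((-1) ^ half p * half_product\<^sup>2)"
    by simp
  then show ?thesis
    by (simp add: mult.assoc[symmetric] power_add[symmetric] mult_2[symmetric] power_mult)
qed

section \<open>The coefficient ring\<close>

abbreviation \<O> :: "complex set" where "\<O> \<equiv> coeff_ring p"

sublocale complex_subring \<O>
  by unfold_locales
    (auto simp: coeff_ring_def int_adjoin_one int_adjoin_add int_adjoin_mult int_adjoin_uminus)

lemma coeff_ring_e: "e n \<in> \<O>"
proof -
  have "zeta p \<in> \<O>"
    by (simp add: coeff_ring_def int_adjoin_incl)
  moreover have "e n = zeta p ^ nat (n mod int p)"
    using p_gt_2 power_int_of_nat[of "zeta p" "nat (n mod int p)"] by simp
  ultimately show ?thesis
    by (simp add: power_closed)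
qed

lemma coeff_ring_i_power_half: "\<i> ^ half p \<in> \<O>"
proof (cases "p mod 4 = 3")
  case True
  then show ?thesis
    by (intro power_closed) (simp add: coeff_ring_def int_adjoin_incl)
next
  case False
  then have "even (half p)"
    using p_eq by presburger
  then obtain m where "half p = 2 * m" ..
  then have "\<i> ^ half p = (- 1) ^ m"
    by (simp add: power_mult)
  then show ?thesis
    by (simp add: power_closed uminus_closed one_closed)
qed

text \<open>
  The square roots of \<open>(-1)\<^sup>r\<close> are \<open>\<plusminus> \<i>\<^sup>r\<close>. This lemma lets the proof ignore all signs of Gauss sums and
  of square roots of \<open>p\<close>: only their squares have to be known.
\<close>

lemma coeff_ring_sqrt_sign:
  assumes "x\<^sup>2 = (-1) ^ half p"
  shows "x \<in> \<O>"
proof -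
  have "(\<i> ^ half p)\<^sup>2 = (\<i>\<^sup>2) ^ half p"
    by (simp only: power_mult[symmetric] mult.commute)
  then have "x\<^sup>2 = (\<i> ^ half p)\<^sup>2"
    using assms by simp
  then have "x = \<i> ^ half p \<or> x = - (\<i> ^ half p)"
    by (simp add: power2_eq_iff)
  then show ?thesis
    using coeff_ring_i_power_half uminus_closed by auto
qed

text \<open>
  As \<open>b\<close> is invertible modulo \<open>p\<close>, \<open>\<zeta>\<^sup>a\<close> is a power of \<open>\<zeta>\<^sup>b\<close>, and the quotient is a finite geometric
  series.
\<close>

lemma cyclotomic_quotient:
  assumes "\<not> int p dvd b"
  shows "(1 - e a) / (1 - e b) \<in> \<O>"
proof -
  have "coprime b (int p)"
    using assms prime_int_p by (metis coprime_commute prime_imp_coprime)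
  then obtain t where t: "[b * t = 1] (mod int p)"
    using cong_solve_coprime_int by blast
  define c where "c = nat (t * a mod int p)"
  have "int c = t * a mod int p"
    using p_gt_2 by (simp add: c_def)
  then have "[b * int c = b * (t * a)] (mod int p)"
    by (intro cong_scalar_left) simp
  moreover have "[b * (t * a) = a] (mod int p)"
    using cong_scalar_right[OF t, of a] by (simp add: mult.assoc)
  ultimately have "e (b * int c) = e a"
    by (intro e_cong) (rule cong_trans)
  then have "e a = e b ^ c"
    by (simp add: power_int_mult)
  moreover have "e b \<noteq> 1"
    using assms by (simp add: e_eq_1_iff)
  ultimately have "(1 - e a) / (1 - e b) = (\<Sum>i<c. e b ^ i)"
    by (simp add: sum_gp_strict)
  then show ?thesis
    by (simp add: sum_closed power_closed coeff_ring_e)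
qed

end

section \<open>Vectors as functions on the simple objects\<close>

definition vec_of :: "nat \<Rightarrow> (simple_obj \<Rightarrow> complex) \<Rightarrow> complex vec" where
  "vec_of p f = vec (dim_H p) (\<lambda>i. f (basis_H p ! i))"

lemma vec_of_carrier [simp]: "vec_of p f \<in> carrier_vec (dim_H p)"
  by (simp add: vec_of_def)

lemma set_basis_H: "set (basis_H p) = {Obj_1, Obj_Z, Obj_X, Obj_X'} \<union> Obj_Y ` {1..half p}"
  by (auto simp: basis_H_def)

lemma distinct_basis_H: "distinct (basis_H p)"
  by (auto simp: basis_H_def distinct_map inj_on_def)

lemma vec_of_cong:
  assumes "f Obj_1 = g Obj_1" "f Obj_Z = g Obj_Z" "f Obj_X = g Obj_X" "f Obj_X' = g Obj_X'"
    and "\<And>k. 1 \<le> k \<Longrightarrow> k \<le> half p \<Longrightarrow> f (Obj_Y k) = g (Obj_Y k)"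
  shows "vec_of p f = vec_of p g"
proof -
  have "f b = g b" if "b \<in> set (basis_H p)" for b
    using that assms by (auto simp: set_basis_H)
  then show ?thesis
    by (auto simp: vec_of_def length_basis_H[symmetric] intro!: eq_vecI)
qed

lemma sum_basis_H:
  fixes g :: "simple_obj \<Rightarrow> complex"
  shows "(\<Sum>i = 0..<dim_H p. g (basis_H p ! i)) =
    g Obj_1 + g Obj_Z + (\<Sum>k=1..half p. g (Obj_Y k)) + g Obj_X + g Obj_X'"
proof -
  have "(\<Sum>i = 0..<dim_H p. g (basis_H p ! i)) = sum_list (map g (basis_H p))"
    by (simp add: sum_list_sum_nth length_basis_H)
  also have "sum_list (map g (basis_H p)) =
      g Obj_1 + g Obj_Z + sum_list (map (\<lambda>k. g (Obj_Y k)) [1..<half p + 1]) + g Obj_X + g Obj_X'"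
    by (simp add: basis_H_def comp_def add.assoc del: upt_Suc)
  also have "sum_list (map (\<lambda>k. g (Obj_Y k)) [1..<half p + 1]) = (\<Sum>k=1..half p. g (Obj_Y k))"
    by (simp only: interv_sum_list_conv_sum_set_nat set_upt Suc_eq_plus1[symmetric]
        atLeastLessThanSuc_atLeastAtMost)
  finally show ?thesis .
qed

definition sigma_op :: "nat \<Rightarrow> (simple_obj \<Rightarrow> complex) \<Rightarrow> simple_obj \<Rightarrow> complex" where
  "sigma_op p f b = f Obj_1 * sigma_coeff p Obj_1 b + f Obj_Z * sigma_coeff p Obj_Z b +
     (\<Sum>k=1..half p. f (Obj_Y k) * sigma_coeff p (Obj_Y k) b) +
     f Obj_X * sigma_coeff p Obj_X b + f Obj_X' * sigma_coeff p Obj_X' b"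

lemma rho_sigma_carrier: "rho_sigma p \<in> carrier_mat (dim_H p) (dim_H p)"
  by (simp add: rho_sigma_def)

lemma rho_sigma_vec_of: "rho_sigma p *\<^sub>v vec_of p f = vec_of p (sigma_op p f)"
proof (rule eq_vecI)
  fix i assume "i < dim_vec (vec_of p (sigma_op p f))"
  then have i: "i < dim_H p"
    by (simp add: vec_of_def)
  have "vec_index (rho_sigma p *\<^sub>v vec_of p f) i =
      (\<Sum>j = 0..<dim_H p. f (basis_H p ! j) * sigma_coeff p (basis_H p ! j) (basis_H p ! i))"
    using i by (simp add: rho_sigma_def vec_of_def scalar_prod_def mult.commute)
  also have "\<dots> = vec_index (vec_of p (sigma_op p f)) i"
    using i sum_basis_H[of "\<lambda>b. f b * sigma_coeff p b (basis_H p ! i)" p]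
    by (simp add: vec_of_def sigma_op_def)
  finally show "vec_index (rho_sigma p *\<^sub>v vec_of p f) i = vec_index (vec_of p (sigma_op p f)) i" .
qed (simp add: rho_sigma_def vec_of_def)

definition diag_H :: "nat \<Rightarrow> (simple_obj \<Rightarrow> complex) \<Rightarrow> complex mat" where
  "diag_H p d = mat (dim_H p) (dim_H p) (\<lambda>(i, j). if i = j then d (basis_H p ! j) else 0)"

lemma rho_tau_diag: "rho_tau p = diag_H p (tau_eigenvalue p)"
  by (simp add: rho_tau_def diag_H_def)

lemma diag_H_carrier: "diag_H p d \<in> carrier_mat (dim_H p) (dim_H p)"
  by (simp add: diag_H_def)

lemma diag_H_vec_of: "diag_H p d *\<^sub>v vec_of p f = vec_of p (\<lambda>b. d b * f b)"
proof (rule eq_vecI)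
  fix i assume "i < dim_vec (vec_of p (\<lambda>b. d b * f b))"
  then have i: "i < dim_H p"
    by (simp add: vec_of_def)
  then have "vec_index (diag_H p d *\<^sub>v vec_of p f) i =
      (\<Sum>j = 0..<dim_H p. if j = i then d (basis_H p ! j) * f (basis_H p ! j) else 0)"
    by (simp add: diag_H_def vec_of_def scalar_prod_def if_distrib[of "\<lambda>x. x * _"] eq_commute[of i]
        cong: if_cong)
  also have "\<dots> = vec_index (vec_of p (\<lambda>b. d b * f b)) i"
    using i by (simp add: vec_of_def)
  finally show "vec_index (diag_H p d *\<^sub>v vec_of p f) i = vec_index (vec_of p (\<lambda>b. d b * f b)) i" .
qed (simp add: diag_H_def vec_of_def)

lemma diag_H_inverse:
  assumes "\<And>b. d b \<noteq> 0"
  shows "diag_H p d * diag_H p (\<lambda>b. inverse (d b)) = 1\<^sub>m (dim_H p)"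
proof (rule eq_matI)
  fix i j assume "i < dim_row (1\<^sub>m (dim_H p))" "j < dim_col (1\<^sub>m (dim_H p))"
  then have ij: "i < dim_H p" "j < dim_H p"
    by simp_all
  then have "(diag_H p d * diag_H p (\<lambda>b. inverse (d b))) $$ (i, j) =
     (\<Sum>k = 0..<dim_H p. (if i = k then d (basis_H p ! k) else 0) *
        (if k = j then inverse (d (basis_H p ! j)) else 0))"
    by (simp add: diag_H_def scalar_prod_def)
  also have "\<dots> = (\<Sum>k = 0..<dim_H p.
      if k = i then (if i = j then d (basis_H p ! i) * inverse (d (basis_H p ! j)) else 0) else 0)"
    by (rule sum.cong) auto
  finally show "(diag_H p d * diag_H p (\<lambda>b. inverse (d b))) $$ (i, j) = 1\<^sub>m (dim_H p) $$ (i, j)"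
    using ij assms by simp
qed (simp_all add: diag_H_def)

lemma vec_of_add: "vec_of p (\<lambda>b. f b + g b) = vec_of p f + vec_of p g"
  by (auto simp: vec_of_def intro!: eq_vecI)

lemma vec_of_smult: "vec_of p (\<lambda>b. c * f b) = c \<cdot>\<^sub>v vec_of p f"
  by (auto simp: vec_of_def intro!: eq_vecI)

lemma vec_of_zero: "vec_of p (\<lambda>b. 0) = 0\<^sub>v (dim_H p)"
  by (auto simp: vec_of_def intro!: eq_vecI)

lemma unit_vec_vec_of:
  assumes "i < dim_H p"
  shows "unit_vec (dim_H p) i = vec_of p (\<lambda>b. if b = basis_H p ! i then 1 else 0)"
  using assms distinct_basis_H[of p]
  by (auto simp: vec_of_def nth_eq_iff_index_eq length_basis_H intro!: eq_vecI)

section \<open>The columns of the change of basis\<close>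

abbreviation sqrt_p :: "nat \<Rightarrow> complex" where "sqrt_p p \<equiv> complex_of_real (sqrt (real p))"

text \<open>
  The vector \<open>Q(\<tau>) \<sigma> \<delta>\<^sub>0\<close>, where \<open>\<delta>\<^sub>0\<close> is \<open>1 + Z\<close>: each coefficient of \<open>\<sigma> \<delta>\<^sub>0\<close> is multiplied by the value
  of \<open>Q\<close> at the eigenvalue of \<open>\<tau>\<close>. Identities between these vectors thus become identities between
  polynomials at the eigenvalues.
\<close>

fun eval_vec :: "nat \<Rightarrow> complex poly \<Rightarrow> simple_obj \<Rightarrow> complex" where
  "eval_vec p Q Obj_1 = poly Q 1 / sqrt_p p"
| "eval_vec p Q Obj_Z = poly Q 1 / sqrt_p p"
| "eval_vec p Q (Obj_Y j) = 2 * poly Q (theta p j) / sqrt_p p"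
| "eval_vec p Q Obj_X = 0"
| "eval_vec p Q Obj_X' = 0"

text \<open>The vector called \<open>w\<^sub>k\<close> above.\<close>

abbreviation orbit_vec :: "nat \<Rightarrow> nat \<Rightarrow> simple_obj \<Rightarrow> complex" where
  "orbit_vec p k \<equiv> eval_vec p (Polynomial.monom 1 k)"

fun delta0_vec :: "simple_obj \<Rightarrow> complex" where
  "delta0_vec Obj_1 = 1"
| "delta0_vec Obj_Z = 1"
| "delta0_vec _ = 0"

fun odd_vec :: "simple_obj \<Rightarrow> complex" where
  "odd_vec Obj_1 = 1"
| "odd_vec Obj_Z = - 1"
| "odd_vec _ = 0"

fun spin_vec :: "simple_obj \<Rightarrow> complex" where
  "spin_vec Obj_X = 1"
| "spin_vec Obj_X' = 1"
| "spin_vec _ = 0"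

text \<open>The factor \<open>\<psi>\<close> makes this the image of \<open>X + X'\<close> under \<open>\<tau>\<close>; with \<open>X - X'\<close> itself, the matrix of \<open>\<tau>\<close>
  would contain \<open>\<psi>\<close> instead of its square.\<close>

fun twist_vec :: "nat \<Rightarrow> simple_obj \<Rightarrow> complex" where
  "twist_vec p Obj_X = psi p"
| "twist_vec p Obj_X' = - psi p"
| "twist_vec p _ = 0"

definition basis_vec :: "nat \<Rightarrow> nat \<Rightarrow> simple_obj \<Rightarrow> complex" where
  "basis_vec p k = (if k \<le> half p then orbit_vec p k else if k = half p + 1 then odd_vec
     else if k = half p + 2 then spin_vec else twist_vec p)"

definition base_change :: "nat \<Rightarrow> complex mat" where
  "base_change p = mat (dim_H p) (dim_H p) (\<lambda>(i, k). basis_vec p k (basis_H p ! i))"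

lemma base_change_carrier: "base_change p \<in> carrier_mat (dim_H p) (dim_H p)"
  by (simp add: base_change_def)

lemma col_base_change: "k < dim_H p \<Longrightarrow> col (base_change p) k = vec_of p (basis_vec p k)"
  by (auto simp: base_change_def vec_of_def intro!: eq_vecI)

lemma dim_H_cases:
  obtains (orbit) "k \<le> half p" "basis_vec p k = orbit_vec p k"
  | (odd) "basis_vec p k = odd_vec"
  | (spin) "basis_vec p k = spin_vec"
  | (twist) "basis_vec p k = twist_vec p"
  using that
  by (cases "k \<le> half p"; cases "k = half p + 1"; cases "k = half p + 2") (simp_all add: basis_vec_def)

section \<open>The action of the generators on the columns\<close>

context odd_prime
begin

lemma psi_square: "(psi p)\<^sup>2 = \<i> ^ half p"
proof -
  have "(psi p)\<^sup>2 = exp (of_nat (half p) * (\<i> * of_real (pi / 2)))"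
    unfolding psi_def by (simp add: exp_double[symmetric] mult_ac)
  also have "\<dots> = exp (\<i> * of_real (pi / 2)) ^ half p"
    by (rule exp_of_nat_mult)
  also have "exp (\<i> * of_real (pi / 2)) = \<i>"
    by (metis cis_conv_exp cis_pi_half)
  finally show ?thesis .
qed

lemma psi_nonzero [simp]: "psi p \<noteq> 0"
  by (simp add: psi_def)

lemma theta_power: "theta p j ^ k = e (int (half p) * int k * (int j)\<^sup>2)"
proof -
  have "int (half p) * int k * (int j)\<^sup>2 = int (half p * j\<^sup>2 * k)"
    by (simp add: mult_ac)
  then show ?thesis
    by (simp only: theta_def power_mult[symmetric] power_int_of_nat)
qed

lemma theta_inj:
  assumes "i \<le> half p" "j \<le> half p" "theta p i = theta p j"
  shows "i = j"
proof -
  let ?r = "int (half p)"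
  have "e (?r * (int i)\<^sup>2) = e (?r * (int j)\<^sup>2)"
    using theta_power[of i 1] theta_power[of j 1] assms(3) by simp
  then have "e (?r * (int i)\<^sup>2 - ?r * (int j)\<^sup>2) = 1"
    by (simp add: power_int_diff)
  then have "int p dvd ?r * (int i)\<^sup>2 - ?r * (int j)\<^sup>2"
    by (simp only: e_eq_1_iff)
  moreover have "\<not> int p dvd ?r"
    using half_pos p_eq zdvd_imp_le[of "int p" ?r] by auto
  ultimately have "[(int i)\<^sup>2 = (int j)\<^sup>2] (mod int p)"
    using prime_int_p by (simp add: right_diff_distrib[symmetric] prime_dvd_mult_iff cong_iff_dvd_diff)
  then consider "int p dvd int i - int j" | "int p dvd int i + int j"
    using cong_squares[of "int i" "int j"] by (auto simp: cong_iff_dvd_diff)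
  then show ?thesis
  proof cases
    case 1
    then show ?thesis
      using assms p_eq residue_eqI[of "int i" "int j"] by (simp add: cong_iff_dvd_diff)
  next
    case 2
    then have "i + j = 0"
      using assms p_eq zdvd_imp_le[of "int p" "int i + int j"] by linarith
    then show ?thesis
      by simp
  qed
qed

lemma theta_0: "theta p 0 = 1"
  by (simp add: theta_def)

lemma sqrt_p_square: "sqrt_p p * sqrt_p p = of_nat p"
  by (metis of_nat_0_le_iff of_real_mult of_real_of_nat_eq real_sqrt_mult_self abs_of_nat)

lemma sqrt_p_nonzero [simp]: "sqrt_p p \<noteq> 0"
  using p_gt_2 by simp

lemma sigma_coeff_Y_Y:
  "sigma_coeff p (Obj_Y j) (Obj_Y m) = (e (int m * int j) + e (int m * - int j)) / sqrt_p p"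
proof -
  have "e (int m * int j) + e (int m * - int j) = complex_of_real (2 * cos (2 * pi * real m * real j / real p))"
    by (simp add: e_cis complex_eq_iff mult.assoc)
  then show ?thesis
    by (simp add: mult_ac)
qed

lemma sigma_orbit_1_Z:
  assumes "b = Obj_1 \<or> b = Obj_Z"
  shows "sigma_op p (orbit_vec p k) b = gauss (int (half p) * int k) / of_nat p"
proof -
  have "sigma_op p (orbit_vec p k) b =
      1 / (sqrt_p p * sqrt_p p) + (\<Sum>j=1..half p. 2 * theta p j ^ k / (sqrt_p p * sqrt_p p))"
    using assms by (auto simp: sigma_op_def poly_monom)
  also have "\<dots> = (1 + 2 * (\<Sum>j=1..half p. theta p j ^ k)) / of_nat p"
    by (simp add: sqrt_p_square sum_divide_distrib[symmetric] sum_distrib_left[symmetric] add_divide_distrib)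
  also have "\<dots> = gauss (int (half p) * int k) / of_nat p"
    by (simp only: gauss_symmetric theta_power)
  finally show ?thesis .
qed

lemma sigma_orbit_Obj_Y:
  "sigma_op p (orbit_vec p k) (Obj_Y m) =
     2 / of_nat p * (\<Sum>j\<in>{0..<int p}. e (int (half p) * int k * j\<^sup>2 + int m * j))"
proof -
  let ?F = "\<lambda>j. e (int (half p) * int k * j\<^sup>2 + int m * j)"
  have "sigma_op p (orbit_vec p k) (Obj_Y m) = 2 / (sqrt_p p * sqrt_p p) +
      (\<Sum>j=1..half p. 2 * theta p j ^ k / sqrt_p p * ((e (int m * int j) + e (int m * - int j)) / sqrt_p p))"
    unfolding sigma_op_def sigma_coeff_Y_Y by (simp add: poly_monom)
  also have "\<dots> = 2 / of_nat p + (\<Sum>j=1..half p. 2 / of_nat p * (?F (int j) + ?F (- int j)))"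
    by (simp only: theta_power e_add) (simp add: sqrt_p_square distrib_left add_divide_distrib mult.assoc)
  also have "\<dots> = 2 / of_nat p * (?F 0 + (\<Sum>j=1..half p. ?F (int j) + ?F (- int j)))"
    by (simp add: sum_distrib_left distrib_left)
  also have "?F 0 + (\<Sum>j=1..half p. ?F (int j) + ?F (- int j)) = (\<Sum>j\<in>{0..<int p}. ?F j)"
    by (rule sum_residues_symmetric[symmetric])
      (intro e_cong cong_add cong_scalar_left cong_pow)
  finally show ?thesis .
qed

text \<open>
  The Fourier transform of a chirp, in the basis of simple objects.
\<close>

lemma sigma_orbit:
  assumes kk': "[int k * int k' = - 1] (mod int p)"
  shows "vec_of p (sigma_op p (orbit_vec p k)) =
    vec_of p (\<lambda>b. gauss (int (half p) * int k) / sqrt_p p * orbit_vec p k' b)"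
proof (rule vec_of_cong)
  show "sigma_op p (orbit_vec p k) (Obj_Y m) =
      gauss (int (half p) * int k) / sqrt_p p * orbit_vec p k' (Obj_Y m)" for m
    unfolding sigma_orbit_Obj_Y gauss_complete_square[OF kk']
    by (simp add: poly_monom theta_power sqrt_p_square)
qed (simp_all add: sigma_orbit_1_Z poly_monom sqrt_p_square, simp_all add: sigma_op_def)

lemma sigma_orbit_0: "vec_of p (sigma_op p (orbit_vec p 0)) = vec_of p delta0_vec"
proof (rule vec_of_cong)
  fix m assume m: "1 \<le> m" "m \<le> half p"
  then have "\<not> int p dvd int m"
    using p_eq zdvd_imp_le[of "int p" "int m"] by auto
  then show "sigma_op p (orbit_vec p 0) (Obj_Y m) = delta0_vec (Obj_Y m)"
    unfolding sigma_orbit_Obj_Y by (simp add: sum_e)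
next
  have "gauss 0 = of_nat p"
    by (simp add: gauss_def)
  then show "sigma_op p (orbit_vec p 0) Obj_1 = delta0_vec Obj_1"
      "sigma_op p (orbit_vec p 0) Obj_Z = delta0_vec Obj_Z"
    using p_gt_2 sigma_orbit_1_Z[of Obj_1 0] sigma_orbit_1_Z[of Obj_Z 0] by simp_all
qed (simp_all add: sigma_op_def)

lemma sigma_delta0: "vec_of p (sigma_op p delta0_vec) = vec_of p (orbit_vec p 0)"
  by (rule vec_of_cong) (simp_all add: sigma_op_def poly_monom)

lemma sigma_odd: "vec_of p (sigma_op p odd_vec) = vec_of p spin_vec"
  by (rule vec_of_cong) (simp_all add: sigma_op_def)

lemma sigma_spin: "vec_of p (sigma_op p spin_vec) = vec_of p odd_vec"
  by (rule vec_of_cong) (simp_all add: sigma_op_def)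

lemma sigma_twist: "vec_of p (sigma_op p (twist_vec p)) = vec_of p (twist_vec p)"
  by (rule vec_of_cong) (simp_all add: sigma_op_def)

end

section \<open>The lattice spanned by the columns\<close>

text \<open>
  Two subrings are of interest: the coefficient ring, for which the lattice has to be preserved,
  and the field of all complex numbers, for which the statement that the lattice is everything says
  that the columns are a basis.
\<close>

locale odd_prime_subring = odd_prime p + S: complex_subring R
  for p :: nat and R :: "complex set"
begin

definition in_lattice :: "(simple_obj \<Rightarrow> complex) \<Rightarrow> bool" where
  "in_lattice f \<longleftrightarrow> vec_of p f \<in> S.lattice (base_change p)"

lemma in_lattice_cong: "vec_of p f = vec_of p g \<Longrightarrow> in_lattice f \<longleftrightarrow> in_lattice g"
  by (simp add: in_lattice_def)

lemma in_lattice_add: "in_lattice f \<Longrightarrow> in_lattice g \<Longrightarrow> in_lattice (\<lambda>b. f b + g b)"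
  unfolding in_lattice_def vec_of_add by (rule S.lattice_add[OF base_change_carrier])

lemma in_lattice_smult: "c \<in> R \<Longrightarrow> in_lattice f \<Longrightarrow> in_lattice (\<lambda>b. c * f b)"
  unfolding in_lattice_def vec_of_smult by (rule S.lattice_smult[OF base_change_carrier])

lemma in_lattice_sum:
  assumes "finite I" "\<And>i. i \<in> I \<Longrightarrow> in_lattice (f i)"
  shows "in_lattice (\<lambda>b. \<Sum>i\<in>I. f i b)"
  using assms
proof (induction I rule: finite_induct)
  case empty
  then show ?case
    using S.lattice_zero[OF base_change_carrier] by (simp add: in_lattice_def vec_of_zero)
next
  case (insert i I)
  then show ?case
    using in_lattice_add[of "f i" "\<lambda>b. \<Sum>i\<in>I. f i b"] by simp
qed

lemma in_lattice_basis_vec: "k < dim_H p \<Longrightarrow> in_lattice (basis_vec p k)"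
  using S.lattice_col[OF base_change_carrier] by (simp add: in_lattice_def col_base_change)

lemma in_lattice_odd: "in_lattice odd_vec"
  using in_lattice_basis_vec[of "half p + 1"] by (simp add: basis_vec_def dim_H_def)

lemma in_lattice_spin: "in_lattice spin_vec"
  using in_lattice_basis_vec[of "half p + 2"] by (simp add: basis_vec_def dim_H_def)

lemma in_lattice_twist: "in_lattice (twist_vec p)"
  using in_lattice_basis_vec[of "half p + 3"] by (simp add: basis_vec_def dim_H_def)

lemma in_lattice_eval_vec:
  assumes "S.poly_over Q" "Polynomial.degree Q \<le> half p"
  shows "in_lattice (eval_vec p Q)"
proof -
  have "in_lattice (\<lambda>b. \<Sum>k\<le>half p. Polynomial.coeff Q k * orbit_vec p k b)"
  proof (intro in_lattice_sum in_lattice_smult)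
    fix k assume "k \<in> {..half p}"
    then show "in_lattice (orbit_vec p k)"
      using in_lattice_basis_vec[of k] by (simp add: basis_vec_def dim_H_def)
  qed (use assms in \<open>simp_all add: S.poly_over_def\<close>)
  moreover have "poly Q x = (\<Sum>k\<le>half p. Polynomial.coeff Q k * x ^ k)" for x
    by (subst poly_as_sum_of_monoms'[OF assms(2), symmetric]) (simp add: poly_sum poly_monom)
  then have "(\<Sum>k\<le>half p. Polynomial.coeff Q k * orbit_vec p k b) = eval_vec p Q b" for b
    by (cases b) (simp_all add: poly_monom sum_divide_distrib sum_distrib_left mult_ac)
  ultimately show ?thesis
    by simp
qed

text \<open>
  The characteristic polynomial \<open>P\<close> of \<open>\<tau>\<close> on the large piece is monic over \<open>R\<close>; so every power \<open>x\<^sup>k\<close> can be replaced by a polynomial over \<open>R\<close> of degree at most \<open>r\<close> with the same values at the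
  eigenvalues.
\<close>

lemma in_lattice_orbit:
  assumes theta_R: "\<And>j. theta p j \<in> R"
  shows "in_lattice (orbit_vec p k)"
proof -
  define P where "P = (\<Prod>j\<le>half p. [:- theta p j, 1:])"
  have deg: "Polynomial.degree P = half p + 1"
    by (simp add: P_def degree_prod_eq_sum_degree)
  have monic: "Polynomial.coeff P (half p + 1) = 1"
    using lead_coeff_prod[of "\<lambda>j. [:- theta p j, 1:]" "{..half p}"] deg by (simp add: P_def)
  have over: "S.poly_over P"
    unfolding P_def by (intro S.poly_over_prod S.poly_over_linear_factor theta_R)
  have root: "poly P (theta p j) = 0" if "j \<le> half p" for j
    unfolding P_def poly_prod using that by (intro prod_zero) auto
  have "\<exists>Q. S.poly_over Q \<and> Polynomial.degree Q \<le> half p \<and>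
      (\<forall>j\<le>half p. poly Q (theta p j) = theta p j ^ k)"
  proof (induction k)
    case 0
    then show ?case
      by (intro exI[of _ 1]) (simp add: S.poly_over_1)
  next
    case (Suc k)
    then obtain Q where Q: "S.poly_over Q" "Polynomial.degree Q \<le> half p"
        "\<forall>j\<le>half p. poly Q (theta p j) = theta p j ^ k"
      by blast
    let ?c = "Polynomial.coeff Q (half p)"
    \<comment> \<open>Multiply by \<open>x\<close> and cancel the term of degree \<open>r + 1\<close> against the monic \<open>P\<close>.\<close>
    let ?Q' = "pCons 0 Q - Polynomial.smult ?c P"
    have cR: "?c \<in> R"
      using Q(1) by (simp add: S.poly_over_def)
    have "Polynomial.degree ?Q' \<le> half p"
    proof (rule degree_le, intro allI impI)
      fix i assume i: "half p < i"
      show "Polynomial.coeff ?Q' i = 0"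
      proof (cases "i = half p + 1")
        case True
        then show ?thesis
          using monic by simp
      next
        case False
        then obtain i' where "i = Suc i'" "half p < i'"
          using i by (cases i) auto
        then show ?thesis
          using Q(2) deg i False by (simp add: coeff_eq_0)
      qed
    qed
    moreover have "S.poly_over ?Q'"
      by (intro S.poly_over_diff S.poly_over_pCons S.poly_over_smult Q over cR S.zero_closed)
    moreover have "\<forall>j\<le>half p. poly ?Q' (theta p j) = theta p j ^ Suc k"
      using Q(3) root by simp
    ultimately show ?case
      by blast
  qed
  then obtain Q where Q: "S.poly_over Q" "Polynomial.degree Q \<le> half p"
      "\<And>j. j \<le> half p \<Longrightarrow> poly Q (theta p j) = theta p j ^ k"
    by blast
  have "vec_of p (orbit_vec p k) = vec_of p (eval_vec p Q)"
    using Q(3)[of 0] Q(3) by (intro vec_of_cong) (simp_all add: poly_monom theta_0)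
  then show ?thesis
    using in_lattice_cong in_lattice_eval_vec[OF Q(1,2)] by blast
qed

text \<open>
  The polynomial \<open>\<surd>p \<Prod>\<^sub>j (x - \<theta>\<^sub>j) / (1 - \<theta>\<^sub>j)\<close> takes the value \<open>\<surd>p\<close> at \<open>1\<close> and vanishes at the other
  eigenvalues; by the hypothesis \<open>unit\<close> its coefficients lie in \<open>R\<close>.
\<close>

lemma in_lattice_delta0:
  assumes theta_R: "\<And>j. theta p j \<in> R"
    and unit: "sqrt_p p / (\<Prod>j=1..half p. 1 - theta p j) \<in> R"
  shows "in_lattice delta0_vec"
proof -
  let ?c = "sqrt_p p / (\<Prod>j=1..half p. 1 - theta p j)"
  let ?P = "\<Prod>j=1..half p. [:- theta p j, 1:]"
  let ?Q = "Polynomial.smult ?c ?P"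
  have "S.poly_over ?Q"
    by (intro S.poly_over_smult S.poly_over_prod S.poly_over_linear_factor theta_R unit)
  moreover have "Polynomial.degree ?Q \<le> half p"
    by (rule order_trans[OF degree_smult_le]) (simp add: degree_prod_eq_sum_degree)
  ultimately have "in_lattice (eval_vec p ?Q)"
    by (rule in_lattice_eval_vec)
  moreover have "vec_of p (eval_vec p ?Q) = vec_of p delta0_vec"
  proof (rule vec_of_cong)
    have "1 - theta p j \<noteq> 0" if "j \<in> {1..half p}" for j
      using theta_inj[of j 0] that theta_0 by auto
    then have "(\<Prod>j=1..half p. 1 - theta p j) \<noteq> 0"
      by (simp only: prod_zero_iff finite_atLeastAtMost) blast
    then have "poly ?Q 1 = sqrt_p p"
      by (simp add: poly_prod)
    then show "eval_vec p ?Q Obj_1 = delta0_vec Obj_1" "eval_vec p ?Q Obj_Z = delta0_vec Obj_Z"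
      by (simp_all only: eval_vec.simps delta0_vec.simps divide_self[OF sqrt_p_nonzero])
  next
    fix k assume "1 \<le> k" "k \<le> half p"
    then have "poly ?P (theta p k) = 0"
      unfolding poly_prod by (intro prod_zero) auto
    then show "eval_vec p ?Q (Obj_Y k) = delta0_vec (Obj_Y k)"
      by simp
  qed simp_all
  ultimately show ?thesis
    using in_lattice_cong by blast
qed

end

context odd_prime
begin

text \<open>
  Over the complex numbers every vector is in the lattice: its part in the large piece is found by
  interpolation at the distinct eigenvalues, and its part in the small piece by solving for the
  coefficients of the three remaining columns.
\<close>

lemma base_change_invertible:
  obtains V where "V \<in> carrier_mat (dim_H p) (dim_H p)" "base_change p * V = 1\<^sub>m (dim_H p)"
proof -
  interpret C: odd_prime_subring p UNIV
    by unfold_locales auto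
  have "C.in_lattice f" for f
  proof -
    \<comment> \<open>The value at \<open>1\<close> serves the objects \<open>1\<close> and \<open>Z\<close>, that at \<open>\<theta>\<^sub>j\<close> the object \<open>Y\<^sub>j\<close>.\<close>
    define g where "g x = (if x = 1 then (f Obj_1 + f Obj_Z) / 2
        else f (Obj_Y (THE j. j \<in> {1..half p} \<and> theta p j = x)) / 2) * sqrt_p p" for x
    have "finite (theta p ` {..half p})"
      by simp
    from interpolation[OF this, of g] obtain Q where
      Q: "Polynomial.degree Q \<le> card (theta p ` {..half p}) - 1" "\<forall>x\<in>theta p ` {..half p}. poly Q x = g x"
      by blast
    have "card (theta p ` {..half p}) \<le> half p + 1"
      using card_image_le[of "{..half p}" "theta p"] by simp
    then have "Polynomial.degree Q \<le> half p"
      using Q(1) by linarith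
    then have evQ: "C.in_lattice (eval_vec p Q)"
      by (intro C.in_lattice_eval_vec) (simp_all add: C.S.poly_over_def)
    have Q1: "poly Q 1 = (f Obj_1 + f Obj_Z) / 2 * sqrt_p p"
      using Q(2) theta_0 by (force simp: g_def)
    have QY: "poly Q (theta p j) = f (Obj_Y j) / 2 * sqrt_p p" if j: "1 \<le> j" "j \<le> half p" for j
    proof -
      have "theta p j \<noteq> 1"
        using theta_inj[of j 0] theta_0 j by auto
      moreover have "(THE i. i \<in> {1..half p} \<and> theta p i = theta p j) = j"
        using j theta_inj by (intro the_equality) auto
      ultimately have "g (theta p j) = f (Obj_Y j) / 2 * sqrt_p p"
        by (simp add: g_def)
      then show ?thesis
        using Q(2) j by simp
    qed
    let ?h = "\<lambda>b. (eval_vec p Q b + (f Obj_1 - f Obj_Z) / 2 * odd_vec b) +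
       ((f Obj_X + f Obj_X') / 2 * spin_vec b + (f Obj_X - f Obj_X') / (2 * psi p) * twist_vec p b)"
    have "C.in_lattice ?h"
      by (intro C.in_lattice_add C.in_lattice_smult evQ C.in_lattice_odd C.in_lattice_spin
          C.in_lattice_twist UNIV_I)
    moreover have "vec_of p f = vec_of p ?h"
      using p_gt_2 by (intro vec_of_cong) (simp_all add: Q1 QY field_simps)
    ultimately show ?thesis
      using C.in_lattice_cong by blast
  qed
  then have "unit_vec (dim_H p) k \<in> C.S.lattice (base_change p)" if "k < dim_H p" for k
    unfolding unit_vec_vec_of[OF that] C.in_lattice_def .
  then have "\<exists>N\<in>carrier_mat (dim_H p) (dim_H p). elements_mat N \<subseteq> UNIV \<and>
      1\<^sub>m (dim_H p) = base_change p * N"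
    by (intro C.S.lattice_factorisation base_change_carrier) simp_all
  then show ?thesis
    using that by metis
qed

lemma mat_eq_one_of_columns:
  assumes M: "M \<in> carrier_mat (dim_H p) (dim_H p)"
    and cols: "\<And>k. k < dim_H p \<Longrightarrow> M *\<^sub>v col (base_change p) k = col (base_change p) k"
  shows "M = 1\<^sub>m (dim_H p)"
proof -
  obtain V where V: "V \<in> carrier_mat (dim_H p) (dim_H p)" "base_change p * V = 1\<^sub>m (dim_H p)"
    by (rule base_change_invertible)
  have "M * base_change p = base_change p"
  proof (rule mat_col_eqI)
    fix k assume "k < dim_col (base_change p)"
    then have "k < dim_H p"
      by (simp add: base_change_def)
    then show "col (M * base_change p) k = col (base_change p) k"
      using cols col_mult2[OF M base_change_carrier] by simp
  qed (use M in \<open>simp_all add: base_change_def\<close>)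
  then have "M * (base_change p * V) = base_change p * V"
    by (simp only: assoc_mult_mat[OF M base_change_carrier V(1), symmetric])
  then show ?thesis
    using V M by simp
qed

lemma inverse_residue:
  assumes "1 \<le> k" "k \<le> half p"
  obtains k' :: nat where "[int k * int k' = - 1] (mod int p)"
proof -
  have "\<not> int p dvd int k"
    using assms p_eq zdvd_imp_le[of "int p" "int k"] by auto
  then have "coprime (int k) (int p)"
    using prime_int_p by (metis coprime_commute prime_imp_coprime)
  then obtain t where t: "[int k * t = 1] (mod int p)"
    using cong_solve_coprime_int by blast
  have "int (nat (- t mod int p)) = - t mod int p"
    using p_gt_2 by simp
  then have "[int k * int (nat (- t mod int p)) = int k * - t] (mod int p)"
    by (intro cong_scalar_left) simp
  moreover have "[int k * - t = - 1] (mod int p)"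
    using cong_minus_minus_iff[of "int k * t" 1 "int p"] t by simp
  ultimately show ?thesis
    using that cong_trans by blast
qed

lemma sigma_op_smult: "sigma_op p (\<lambda>b. c * f b) = (\<lambda>b. c * sigma_op p f b)"
  by (rule ext) (simp add: sigma_op_def distrib_left sum_distrib_left mult.assoc)

text \<open>
  It suffices to check the columns of the change of basis. On an orbit vector with \<open>k \<noteq> 0\<close> the two
  Gauss sums that occur multiply to \<open>p\<close>.
\<close>

lemma rho_sigma_involution: "rho_sigma p * rho_sigma p = 1\<^sub>m (dim_H p)"
proof (rule mat_eq_one_of_columns)
  show "rho_sigma p * rho_sigma p \<in> carrier_mat (dim_H p) (dim_H p)"
    by (rule mult_carrier_mat[OF rho_sigma_carrier rho_sigma_carrier])
  fix k assume k: "k < dim_H p"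
  have "rho_sigma p *\<^sub>v (rho_sigma p *\<^sub>v vec_of p (basis_vec p k)) = vec_of p (basis_vec p k)"
  proof (cases rule: dim_H_cases[of k p])
    case orbit
    show ?thesis
    proof (cases "k = 0")
      case True
      then have "basis_vec p k = orbit_vec p 0"
        using orbit(2) by (simp only:)
      moreover have "rho_sigma p *\<^sub>v vec_of p (orbit_vec p 0) = vec_of p delta0_vec"
        by (simp only: rho_sigma_vec_of sigma_orbit_0)
      moreover have "rho_sigma p *\<^sub>v vec_of p delta0_vec = vec_of p (orbit_vec p 0)"
        by (simp only: rho_sigma_vec_of sigma_delta0)
      ultimately show ?thesis
        by (simp only:)
    next
      case False
      then obtain k' where kk': "[int k * int k' = - 1] (mod int p)"
        using inverse_residue orbit(1) by (metis less_one not_le)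
      then have k'k: "[int k' * int k = - 1] (mod int p)"
        by (simp add: mult.commute)
      let ?r = "int (half p)"
      let ?g = "gauss (?r * int k) / sqrt_p p" and ?g' = "gauss (?r * int k') / sqrt_p p"
      have "?g * ?g' = 1"
        using gauss_mult_gauss[OF kk'] p_gt_2 by (simp add: sqrt_p_square)
      have "rho_sigma p *\<^sub>v (rho_sigma p *\<^sub>v vec_of p (orbit_vec p k)) =
          rho_sigma p *\<^sub>v vec_of p (\<lambda>b. ?g * orbit_vec p k' b)"
        by (simp only: rho_sigma_vec_of[of p "orbit_vec p k"] sigma_orbit[OF kk'])
      also have "\<dots> = ?g \<cdot>\<^sub>v vec_of p (sigma_op p (orbit_vec p k'))"
        by (simp only: rho_sigma_vec_of sigma_op_smult) (simp only: vec_of_smult)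
      also have "\<dots> = (?g * ?g') \<cdot>\<^sub>v vec_of p (orbit_vec p k)"
        by (simp only: sigma_orbit[OF k'k] vec_of_smult smult_smult_assoc)
      finally show ?thesis
        unfolding orbit(2) \<open>?g * ?g' = 1\<close> by simp
    qed
  next
    case odd
    show ?thesis
      unfolding odd rho_sigma_vec_of[of p odd_vec] sigma_odd rho_sigma_vec_of sigma_spin ..
  next
    case spin
    show ?thesis
      unfolding spin rho_sigma_vec_of[of p spin_vec] sigma_spin rho_sigma_vec_of sigma_odd ..
  next
    case twist
    show ?thesis
      unfolding twist rho_sigma_vec_of[of p "twist_vec p"] sigma_twist rho_sigma_vec_of sigma_twist ..
  qed
  then show "rho_sigma p * rho_sigma p *\<^sub>v col (base_change p) k = col (base_change p) k"
    using k by (simp add: col_base_change assoc_mult_mat_vec[OF rho_sigma_carrier rho_sigma_carrier])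
qed

sublocale odd_prime_subring p \<O>
  by unfold_locales

lemma theta_e: "theta p j = e (int (half p) * (int j)\<^sup>2)"
  using theta_power[of j 1] by simp

lemma theta_in_coeff_ring: "theta p j \<in> \<O>"
  unfolding theta_e by (rule coeff_ring_e)

text \<open>
  Up to a factor \<open>\<plusminus> \<i>\<^sup>r\<close>, the numerator may be replaced by the half product, whose factors
  \<open>\<zeta>\<^sup>j - \<zeta>\<^bsup>-j\<^esup> = \<zeta>\<^sup>j (1 - \<zeta>\<^bsup>-2j\<^esup>)\<close> are divisible by \<open>1 - \<theta>\<^sub>j\<close> one at a time.
\<close>

lemma sqrt_p_quotient: "sqrt_p p / (\<Prod>j=1..half p. 1 - theta p j) \<in> \<O>"
proof -
  have "sqrt_p p / half_product \<in> \<O>"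
  proof (rule coeff_ring_sqrt_sign)
    have "(sqrt_p p / half_product)\<^sup>2 = of_nat p / ((-1) ^ half p * of_nat p)"
      by (simp only: power_divide half_product_square power2_eq_square[of "sqrt_p p"] sqrt_p_square)
    also have "\<dots> = (-1) ^ half p"
      using p_gt_2 by (cases "even (half p)") simp_all
    finally show "(sqrt_p p / half_product)\<^sup>2 = (-1) ^ half p" .
  qed
  moreover have "half_product / (\<Prod>j=1..half p. 1 - theta p j) \<in> \<O>"
    unfolding half_product_def prod_dividef[symmetric]
  proof (rule prod_closed)
    fix j assume j: "j \<in> {1..half p}"
    have "\<not> int p dvd int (half p) * (int j)\<^sup>2"
    proof
      assume "int p dvd int (half p) * (int j)\<^sup>2"
      then have "theta p j = theta p 0"
        unfolding theta_0 by (simp only: theta_e e_eq_1_iff)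
      then show False
        using theta_inj[of j 0] j by simp
    qed
    then have "(1 - e (- 2 * int j)) / (1 - theta p j) \<in> \<O>"
      unfolding theta_e by (rule cyclotomic_quotient)
    then have "e (int j) * ((1 - e (- 2 * int j)) / (1 - theta p j)) \<in> \<O>"
      by (intro mult_closed coeff_ring_e)
    moreover have "e (int j) - e (- int j) = e (int j) * (1 - e (- 2 * int j))"
      unfolding right_diff_distrib e_add[symmetric] by simp
    ultimately show "(e (int j) - e (- int j)) / (1 - theta p j) \<in> \<O>"
      by simp
  qed
  ultimately have "sqrt_p p / half_product * (half_product / (\<Prod>j=1..half p. 1 - theta p j)) \<in> \<O>"
    by (rule mult_closed)
  moreover have "half_product \<noteq> 0"
    using half_product_square p_gt_2 by auto
  ultimately show ?thesis
    by simp
qed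

lemma gauss_quotient:
  assumes "\<not> int p dvd k"
  shows "gauss (int (half p) * k) / sqrt_p p \<in> \<O>"
proof (rule coeff_ring_sqrt_sign)
  have "(gauss (int (half p) * k) / sqrt_p p)\<^sup>2 = (-1) ^ half p * of_nat p / of_nat p"
    by (simp only: power_divide gauss_square[OF assms] power2_eq_square[of "sqrt_p p"] sqrt_p_square)
  then show "(gauss (int (half p) * k) / sqrt_p p)\<^sup>2 = (-1) ^ half p"
    using p_gt_2 by simp
qed

lemma in_lattice_sigma:
  assumes "k < dim_H p"
  shows "in_lattice (sigma_op p (basis_vec p k))"
proof (cases rule: dim_H_cases[of k p])
  case orbit
  show ?thesis
  proof (cases "k = 0")
    case True
    then show ?thesis
      using orbit(2) in_lattice_cong[OF sigma_orbit_0]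
        in_lattice_delta0[OF theta_in_coeff_ring sqrt_p_quotient] by simp
  next
    case False
    then obtain k' where kk': "[int k * int k' = - 1] (mod int p)"
      using inverse_residue orbit(1) by (metis less_one not_le)
    have "\<not> int p dvd int k"
      using False orbit(1) p_eq zdvd_imp_le[of "int p" "int k"] by auto
    then show ?thesis
      unfolding orbit(2) in_lattice_cong[OF sigma_orbit[OF kk']]
      by (intro in_lattice_smult gauss_quotient in_lattice_orbit theta_in_coeff_ring)
  qed
next
  case odd
  then show ?thesis
    using in_lattice_cong[OF sigma_odd] in_lattice_spin by simp
next
  case spin
  then show ?thesis
    using in_lattice_cong[OF sigma_spin] in_lattice_odd by simp
next
  case twist
  then show ?thesis
    using in_lattice_cong[OF sigma_twist] in_lattice_twist by simp
qed

lemma psi_square_in_coeff_ring: "(psi p)\<^sup>2 \<in> \<O>" "inverse ((psi p)\<^sup>2) \<in> \<O>"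
proof -
  show "(psi p)\<^sup>2 \<in> \<O>"
    unfolding psi_square by (rule coeff_ring_i_power_half)
  have "inverse ((psi p)\<^sup>2) = (\<i> ^ half p) ^ 3"
  proof (rule inverse_unique)
    have "(psi p)\<^sup>2 * (\<i> ^ half p) ^ 3 = (\<i> ^ half p) ^ 4"
      unfolding psi_square by (simp add: eval_nat_numeral)
    also have "\<dots> = (\<i> ^ 4) ^ half p"
      by (simp only: power_mult[symmetric] mult.commute)
    finally show "(psi p)\<^sup>2 * (\<i> ^ half p) ^ 3 = 1"
      by simp
  qed
  then show "inverse ((psi p)\<^sup>2) \<in> \<O>"
    by (simp add: power_closed coeff_ring_i_power_half)
qed

lemma in_lattice_tau:
  assumes "k < dim_H p"
  shows "in_lattice (\<lambda>b. tau_eigenvalue p b * basis_vec p k b)"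
proof (cases rule: dim_H_cases[of k p])
  case orbit
  have "vec_of p (\<lambda>b. tau_eigenvalue p b * orbit_vec p k b) = vec_of p (orbit_vec p (Suc k))"
    by (rule vec_of_cong) (simp_all add: poly_monom)
  then show ?thesis
    unfolding orbit(2) using in_lattice_cong in_lattice_orbit[OF theta_in_coeff_ring] by blast
next
  case odd
  have "vec_of p (\<lambda>b. tau_eigenvalue p b * odd_vec b) = vec_of p odd_vec"
    by (rule vec_of_cong) simp_all
  then show ?thesis
    unfolding odd using in_lattice_cong in_lattice_odd by blast
next
  case spin
  have "vec_of p (\<lambda>b. tau_eigenvalue p b * spin_vec b) = vec_of p (twist_vec p)"
    by (rule vec_of_cong) simp_all
  then show ?thesis
    unfolding spin using in_lattice_cong in_lattice_twist by blast
next
  case twist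
  have "vec_of p (\<lambda>b. tau_eigenvalue p b * twist_vec p b) = vec_of p (\<lambda>b. (psi p)\<^sup>2 * spin_vec b)"
    by (rule vec_of_cong) (simp_all add: power2_eq_square)
  then show ?thesis
    unfolding twist
    using in_lattice_cong in_lattice_smult[OF psi_square_in_coeff_ring(1) in_lattice_spin] by blast
qed

text \<open>
  On the large piece \<open>\<tau>\<close> has order \<open>p\<close>, so its inverse only raises the exponent of an orbit vector by
  \<open>p - 1\<close>; on the small piece it needs \<open>\<psi>\<^sup>2\<close> to be a unit.
\<close>

lemma in_lattice_tau_inverse:
  assumes "k < dim_H p"
  shows "in_lattice (\<lambda>b. inverse (tau_eigenvalue p b) * basis_vec p k b)"
proof (cases rule: dim_H_cases[of k p])
  case orbit
  have "theta p j ^ p = 1" for j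
    unfolding theta_power by (simp add: e_eq_1_iff)
  then have "inverse (theta p j) = theta p j ^ (p - 1)" for j
    using p_gt_2 by (intro inverse_unique) (simp add: power_Suc[symmetric])
  then have "vec_of p (\<lambda>b. inverse (tau_eigenvalue p b) * orbit_vec p k b) =
      vec_of p (orbit_vec p (p - 1 + k))"
    by (intro vec_of_cong) (simp_all add: poly_monom power_add)
  then show ?thesis
    unfolding orbit(2) using in_lattice_cong in_lattice_orbit[OF theta_in_coeff_ring] by blast
next
  case odd
  have "vec_of p (\<lambda>b. inverse (tau_eigenvalue p b) * odd_vec b) = vec_of p odd_vec"
    by (rule vec_of_cong) simp_all
  then show ?thesis
    unfolding odd using in_lattice_cong in_lattice_odd by blast
next
  case spin
  have "vec_of p (\<lambda>b. inverse (tau_eigenvalue p b) * spin_vec b) =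
      vec_of p (\<lambda>b. inverse ((psi p)\<^sup>2) * twist_vec p b)"
    by (rule vec_of_cong) (simp_all add: power2_eq_square)
  then show ?thesis
    unfolding spin
    using in_lattice_cong in_lattice_smult[OF psi_square_in_coeff_ring(2) in_lattice_twist] by blast
next
  case twist
  have "vec_of p (\<lambda>b. inverse (tau_eigenvalue p b) * twist_vec p b) = vec_of p spin_vec"
    by (rule vec_of_cong) simp_all
  then show ?thesis
    unfolding twist using in_lattice_cong in_lattice_spin by blast
qed

lemma tau_eigenvalue_nonzero: "tau_eigenvalue p b \<noteq> 0"
  by (cases b) (simp_all add: theta_def)

lemma integral_rho_sigma: "integral_in (base_change p) (dim_H p) (rho_sigma p)"
  using in_lattice_sigma
  by (intro integral_inI base_change_carrier rho_sigma_carrier)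
    (simp add: col_base_change rho_sigma_vec_of in_lattice_def)

lemma integral_rho_tau: "integral_in (base_change p) (dim_H p) (rho_tau p)"
  using in_lattice_tau unfolding rho_tau_diag
  by (intro integral_inI base_change_carrier diag_H_carrier)
    (simp add: col_base_change diag_H_vec_of in_lattice_def)

lemma integral_rho_tau_inverse:
  "integral_in (base_change p) (dim_H p) (diag_H p (\<lambda>b. inverse (tau_eigenvalue p b)))"
  using in_lattice_tau_inverse
  by (intro integral_inI base_change_carrier diag_H_carrier)
    (simp add: col_base_change diag_H_vec_of in_lattice_def)

text \<open>
  The inverses of generators have to be treated separately, because an integral matrix need not
  have an integral inverse.
\<close>

lemma integral_rho_image:
  assumes "M \<in> rho_image p"
  shows "M \<in> carrier_mat (dim_H p) (dim_H p) \<and> integral_in (base_change p) (dim_H p) M"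
  using assms unfolding rho_image_def
proof (induction rule: generate.induct)
  case one
  have "\<one>\<^bsub>GL (dim_H p)\<^esub> = 1\<^sub>m (dim_H p)"
    by (simp add: GL_def units_of_one ring_mat_simps)
  then show ?case
    using integral_in_one[OF base_change_carrier] by simp
next
  case (incl h)
  then show ?case
    using integral_rho_sigma integral_rho_tau rho_sigma_carrier diag_H_carrier
    by (auto simp: rho_tau_diag)
next
  case (inv h)
  have "inv\<^bsub>GL (dim_H p)\<^esub> (rho_sigma p) = rho_sigma p"
    by (rule GL_inverse[OF rho_sigma_carrier rho_sigma_carrier rho_sigma_involution])
  moreover have "inv\<^bsub>GL (dim_H p)\<^esub> (rho_tau p) = diag_H p (\<lambda>b. inverse (tau_eigenvalue p b))"
    unfolding rho_tau_diag
    by (rule GL_inverse[OF diag_H_carrier diag_H_carrier diag_H_inverse[OF tau_eigenvalue_nonzero]])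
  ultimately show ?case
    using inv integral_rho_sigma integral_rho_tau_inverse rho_sigma_carrier diag_H_carrier by auto
next
  case (eng h1 h2)
  have "h1 \<otimes>\<^bsub>GL (dim_H p)\<^esub> h2 = h1 * h2"
    by (simp add: GL_def units_of_mult ring_mat_simps)
  then show ?case
    using eng integral_in_mult[OF base_change_carrier] by auto
qed

end

theorem theorem1:
  fixes p :: nat
  assumes "Factorial_Ring.prime p" and "odd p" and "p \<ge> 5"
  shows "\<exists>W \<in> carrier (GL (dim_H p)).
           (\<forall>M \<in> rho_image p.
              elements_mat (inv\<^bsub>GL (dim_H p)\<^esub> W * M * W) \<subseteq> coeff_ring p) \<and>
           elements_mat (inv\<^bsub>GL (dim_H p)\<^esub> W * rho_sigma p * W) \<subseteq> coeff_ring p \<and>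
           elements_mat (inv\<^bsub>GL (dim_H p)\<^esub> W * rho_tau p * W) \<subseteq> coeff_ring p"
proof -
  interpret odd_prime p
    by unfold_locales (use assms in auto)
  let ?W = "base_change p" and ?n = "dim_H p"
  obtain V where V: "V \<in> carrier_mat ?n ?n" "?W * V = 1\<^sub>m ?n"
    by (rule base_change_invertible)
  have VW: "V * ?W = 1\<^sub>m ?n"
    by (rule mat_mult_left_right_inverse[OF base_change_carrier V])
  note W = GL_inverse[OF base_change_carrier V]
  have integral: "elements_mat (inv\<^bsub>GL ?n\<^esub> ?W * M * ?W) \<subseteq> coeff_ring p" if "M \<in> rho_image p" for M
    unfolding W(2)
    by (rule integral_in_conjugate[OF base_change_carrier V(1) _ VW]) (use integral_rho_image[OF that] in auto)
  have "rho_sigma p \<in> rho_image p" "rho_tau p \<in> rho_image p"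
    by (auto simp: rho_image_def intro: generate.incl)
  then show ?thesis
    using W(1) integral by blast
qed

end
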